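(* Let $(M,h)$ be a closed, compact, connected, oriented smooth Riemannian manifold of dimension $d\ge 1$. There exist $N=N(M)$ smooth vector fields $a_1,\dots,a_N$ on $M$ such that $$\frac12\sum_{i=1}^N a_i\bigl(a_i(\psi)\bigr)=\Delta_h\psi-\frac12\sum_{i=1}^N\bar a_i(\psi)\qquad\text{for all }\psi\in C^2(M),$$ where $\Delta_h$ is the Laplace-Beltrami operator of $(M,h)$ and $\bar a_1,\dots,\bar a_N$ are the first order differential operators $\bar a_i:=(\operatorname{div}_h a_i)\,a_i$, $i=1,\dots,N$.
   Context: For a vector field $X$ and a $C^1$ function $f$ on $M$, $X(f)=(X,\operatorname{grad}_h f)_h$, locally $X^j\partial_jf$. $\operatorname{div}_h$ is the Riemannian divergence. $\Delta_h\psi=\operatorname{div}_h(\operatorname{grad}_h\psi)$. *)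

theory Defs
  imports "HOL-Analysis.Analysis"
begin

(* C^k on a set S, meant for open S: f is Frechet differentiable at every point of S and all its
   directional derivatives are C^(k-1). *)
primrec Ck_on :: "nat \<Rightarrow> ('a::real_normed_vector \<Rightarrow> 'b::real_normed_vector) \<Rightarrow> 'a set \<Rightarrow> bool" where
  "Ck_on 0 f S \<longleftrightarrow> continuous_on S f"
| "Ck_on (Suc k) f S \<longleftrightarrow>
     (\<forall>x\<in>S. f differentiable (at x)) \<and> (\<forall>v. Ck_on k (\<lambda>x. frechet_derivative f (at x) v) S)"

definition smooth_on :: "('a::real_normed_vector \<Rightarrow> 'b::real_normed_vector) \<Rightarrow> 'a set \<Rightarrow> bool" where
  "smooth_on f S \<longleftrightarrow> (\<forall>k. Ck_on k f S)"

(* A chart is a pair (U, \<phi>); the values of \<phi> outside U are irrelevant.  The dimension of the manifold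
   is CARD('d), which is at least 1. *)
type_synonym ('m, 'd) chart = "'m set \<times> ('m \<Rightarrow> real^'d)"

abbreviation cdom :: "('m, 'd) chart \<Rightarrow> 'm set" where "cdom c \<equiv> fst c"
abbreviation cmap :: "('m, 'd) chart \<Rightarrow> 'm \<Rightarrow> real^'d" where "cmap c \<equiv> snd c"
abbreviation cimg :: "('m, 'd) chart \<Rightarrow> (real^'d) set" where "cimg c \<equiv> cmap c ` cdom c"
abbreviation cinv :: "('m, 'd) chart \<Rightarrow> real^'d \<Rightarrow> 'm" where "cinv c \<equiv> inv_into (cdom c) (cmap c)"

definition is_chart :: "'m topology \<Rightarrow> ('m, 'd::finite) chart \<Rightarrow> bool" where
  "is_chart X c \<longleftrightarrow> openin X (cdom c) \<and> open (cimg c) \<and>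
     homeomorphic_map (subtopology X (cdom c)) (top_of_set (cimg c)) (cmap c)"

definition transition :: "('m, 'd::finite) chart \<Rightarrow> ('m, 'd) chart \<Rightarrow> real^'d \<Rightarrow> real^'d" where
  "transition c c' = cmap c' \<circ> cinv c"

definition transition_deriv ::
  "('m, 'd::finite) chart \<Rightarrow> ('m, 'd) chart \<Rightarrow> 'm \<Rightarrow> real^'d \<Rightarrow> real^'d" where
  "transition_deriv c c' p = frechet_derivative (transition c c') (at (cmap c p))"

definition smoothly_compatible :: "('m, 'd::finite) chart \<Rightarrow> ('m, 'd) chart \<Rightarrow> bool" where
  "smoothly_compatible c c' \<longleftrightarrow>
     smooth_on (transition c c') (cmap c ` (cdom c \<inter> cdom c')) \<and>
     smooth_on (transition c' c) (cmap c' ` (cdom c \<inter> cdom c'))"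

(* Smooth manifold without boundary; A is the smooth structure, i.e. a maximal smooth atlas. *)
definition smooth_manifold :: "'m topology \<Rightarrow> ('m, 'd::finite) chart set \<Rightarrow> bool" where
  "smooth_manifold X A \<longleftrightarrow>
     Hausdorff_space X \<and> second_countable X \<and>
     (\<forall>c\<in>A. is_chart X c) \<and> (\<Union>c\<in>A. cdom c) = topspace X \<and>
     (\<forall>c\<in>A. \<forall>c'\<in>A. smoothly_compatible c c') \<and>
     (\<forall>c. is_chart X c \<and> (\<forall>c'\<in>A. smoothly_compatible c c') \<longrightarrow> c \<in> A)"

(* An orientation, presented by the charts declared positive. *)
definition orientation ::
  "'m topology \<Rightarrow> ('m, 'd::finite) chart set \<Rightarrow> ('m, 'd) chart set \<Rightarrow> bool" where
  "orientation X A P \<longleftrightarrow> P \<subseteq> A \<and> (\<Union>c\<in>P. cdom c) = topspace X \<and>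
     (\<forall>c\<in>P. \<forall>c'\<in>P. \<forall>p\<in>cdom c \<inter> cdom c'. det (matrix (transition_deriv c c' p)) > 0)"

definition Ck_function ::
  "('m, 'd::finite) chart set \<Rightarrow> nat \<Rightarrow> ('m \<Rightarrow> real) \<Rightarrow> bool" where
  "Ck_function A k f \<longleftrightarrow> (\<forall>c\<in>A. Ck_on k (f \<circ> cinv c) (cimg c))"

(* A tangent vector at p is the family of its components in all charts around p, subject to the
   contravariant transformation law (and 0 at charts that do not contain p, so that the family
   is determined by the vector). *)
type_synonym ('m, 'd) tangent = "('m, 'd) chart \<Rightarrow> real^'d"

definition tangent_space ::
  "('m, 'd::finite) chart set \<Rightarrow> 'm \<Rightarrow> ('m, 'd) tangent set" where
  "tangent_space A p = {v.
     (\<forall>c\<in>A. \<forall>c'\<in>A. p \<in> cdom c \<inter> cdom c' \<longrightarrow> v c' = transition_deriv c c' p (v c)) \<and>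
     (\<forall>c. \<not> (c \<in> A \<and> p \<in> cdom c) \<longrightarrow> v c = 0)}"

(* The coordinate vector \<partial>/\<partial>x_i at p of the chart c. *)
definition coord_vector ::
  "('m, 'd::finite) chart set \<Rightarrow> ('m, 'd) chart \<Rightarrow> 'm \<Rightarrow> 'd \<Rightarrow> ('m, 'd) tangent" where
  "coord_vector A c p i =
     (\<lambda>c'. if c' \<in> A \<and> p \<in> cdom c' then transition_deriv c c' p (axis i 1) else 0)"

definition smooth_vector_field ::
  "'m topology \<Rightarrow> ('m, 'd::finite) chart set \<Rightarrow> ('m \<Rightarrow> ('m, 'd) tangent) \<Rightarrow> bool" where
  "smooth_vector_field X A a \<longleftrightarrow>
     (\<forall>p\<in>topspace X. a p \<in> tangent_space A p) \<and>
     (\<forall>c\<in>A. smooth_on (\<lambda>x. a (cinv c x) c) (cimg c))"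

definition metric_matrix ::
  "('m, 'd::finite) chart set \<Rightarrow> ('m \<Rightarrow> ('m, 'd) tangent \<Rightarrow> ('m, 'd) tangent \<Rightarrow> real) \<Rightarrow>
     ('m, 'd) chart \<Rightarrow> 'm \<Rightarrow> real^'d^'d" where
  "metric_matrix A h c p = (\<chi> i j. h p (coord_vector A c p i) (coord_vector A c p j))"

definition riemannian_metric ::
  "'m topology \<Rightarrow> ('m, 'd::finite) chart set \<Rightarrow>
     ('m \<Rightarrow> ('m, 'd) tangent \<Rightarrow> ('m, 'd) tangent \<Rightarrow> real) \<Rightarrow> bool" where
  "riemannian_metric X A h \<longleftrightarrow>
     (\<forall>p\<in>topspace X.
        (\<forall>u\<in>tangent_space A p. \<forall>v\<in>tangent_space A p. \<forall>w\<in>tangent_space A p. \<forall>r s.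
           h p (\<lambda>c. r *\<^sub>R u c + s *\<^sub>R v c) w = r * h p u w + s * h p v w) \<and>
        (\<forall>u\<in>tangent_space A p. \<forall>v\<in>tangent_space A p. h p u v = h p v u) \<and>
        (\<forall>v\<in>tangent_space A p. v \<noteq> (\<lambda>_. 0) \<longrightarrow> h p v v > 0)) \<and>
     (\<forall>c\<in>A. smooth_on (\<lambda>x. metric_matrix A h c (cinv c x)) (cimg c))"

(* The directional derivative and the divergence below are given by their local coordinate
   expressions, which do not depend on the chart around p; they are evaluated in this one. *)
definition chart_at :: "('m, 'd::finite) chart set \<Rightarrow> 'm \<Rightarrow> ('m, 'd) chart" where
  "chart_at A p = (SOME c. c \<in> A \<and> p \<in> cdom c)"

(* v(f) = v^j \<partial>_j f *)
definition tangent_deriv ::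
  "('m, 'd::finite) chart set \<Rightarrow> 'm \<Rightarrow> ('m, 'd) tangent \<Rightarrow> ('m \<Rightarrow> real) \<Rightarrow> real" where
  "tangent_deriv A p v f =
     (let c = chart_at A p in frechet_derivative (f \<circ> cinv c) (at (cmap c p)) (v c))"

definition apply_field ::
  "('m, 'd::finite) chart set \<Rightarrow> ('m \<Rightarrow> ('m, 'd) tangent) \<Rightarrow> ('m \<Rightarrow> real) \<Rightarrow> 'm \<Rightarrow> real" where
  "apply_field A a f = (\<lambda>p. tangent_deriv A p (a p) f)"

definition gradient ::
  "('m, 'd::finite) chart set \<Rightarrow> ('m \<Rightarrow> ('m, 'd) tangent \<Rightarrow> ('m, 'd) tangent \<Rightarrow> real) \<Rightarrow>
     ('m \<Rightarrow> real) \<Rightarrow> 'm \<Rightarrow> ('m, 'd) tangent" where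
  "gradient A h f = (\<lambda>p. THE v. v \<in> tangent_space A p \<and>
     (\<forall>w\<in>tangent_space A p. h p w v = tangent_deriv A p w f))"

(* |g|^(-1/2) \<partial>_i (|g|^(1/2) a^i) in the chart c, where |g| is the determinant of the metric. *)
definition divergence_in_chart ::
  "('m, 'd::finite) chart set \<Rightarrow> ('m \<Rightarrow> ('m, 'd) tangent \<Rightarrow> ('m, 'd) tangent \<Rightarrow> real) \<Rightarrow>
     ('m, 'd) chart \<Rightarrow> ('m \<Rightarrow> ('m, 'd) tangent) \<Rightarrow> 'm \<Rightarrow> real" where
  "divergence_in_chart A h c a p =
     (\<Sum>i\<in>UNIV. frechet_derivative
        (\<lambda>x. sqrt (det (metric_matrix A h c (cinv c x))) * (a (cinv c x) c) $ i)
        (at (cmap c p)) (axis i 1)) / sqrt (det (metric_matrix A h c p))"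

definition divergence ::
  "('m, 'd::finite) chart set \<Rightarrow> ('m \<Rightarrow> ('m, 'd) tangent \<Rightarrow> ('m, 'd) tangent \<Rightarrow> real) \<Rightarrow>
     ('m \<Rightarrow> ('m, 'd) tangent) \<Rightarrow> 'm \<Rightarrow> real" where
  "divergence A h a = (\<lambda>p. divergence_in_chart A h (chart_at A p) a p)"

definition laplace_beltrami ::
  "('m, 'd::finite) chart set \<Rightarrow> ('m \<Rightarrow> ('m, 'd) tangent \<Rightarrow> ('m, 'd) tangent \<Rightarrow> real) \<Rightarrow>
     ('m \<Rightarrow> real) \<Rightarrow> 'm \<Rightarrow> real" where
  "laplace_beltrami A h f = divergence A h (gradient A h f)"

definition div_times_field ::
  "('m, 'd::finite) chart set \<Rightarrow> ('m \<Rightarrow> ('m, 'd) tangent \<Rightarrow> ('m, 'd) tangent \<Rightarrow> real) \<Rightarrow>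
     ('m \<Rightarrow> ('m, 'd) tangent) \<Rightarrow> ('m \<Rightarrow> real) \<Rightarrow> 'm \<Rightarrow> real" where
  "div_times_field A h a f = (\<lambda>p. divergence A h a p * apply_field A a f p)"

end

theory Submission
  imports Defs
begin

text \<open>
  If $\sum_j a_j \otimes a_j = 2 h^{-1}$, then $\mathrm{grad}\,\psi = \frac12 \sum_j a_j(\psi)\, a_j$, and the
  product rule $\mathrm{div}(f a) = f\, \mathrm{div}\, a + a(f)$ with $f = a_j(\psi)$ gives the identity.
  Such fields arise from finitely many charts by multiplying local orthonormal frames (Gram-Schmidt on the
  coordinate vectors) with $\sqrt2\,\rho_i$, where $\sum_i \rho_i^2 = 1$ and the support of $\rho_i$ lies
  in the $i$-th chart. The number of fields is the dimension times the number of charts, hence independent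
  of the metric.
\<close>

section \<open>Calculus of $C^k$ maps\<close>

text \<open>A manifold need not carry a global frame of \<open>d\<close> fields (the 2-sphere does
  not), so the family has to be redundant. This is harmless because only the sum of the tensor
  squares enters; cutting a field off by \<open>\<rho>\<close> multiplies its square by \<rho>^2,
  which is why the squares of the cutoffs are normalised to sum 1. The constant 2 compensates the
  factor 1/2 of the theorem. The obstacle is the form of the definitions. Derivatives along vectors
  and divergences at p are evaluated in \<open>chart_at A p\<close>, a choice that may vary wildly
  with p, and \<open>frechet_derivative\<close> is an unspecified value where no derivative exists.
  Before anything is differentiated at p, a_j(\<psi>) and the gradient therefore need formulas valid
  on a whole chart image, together with differentiability. The orders just suffice: \<psi> is C^2,
  so a_j(\<psi>) is C^1, and the gradient is a combination of smooth fields with these C^1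
  coefficients.\<close>

lemma Ck_on_cong_imp:
  assumes "open S" "\<And>x. x \<in> S \<Longrightarrow> f x = g x" "Ck_on k f S"
  shows "Ck_on k g S"
  using assms(2,3)
proof (induction k arbitrary: f g)
  case 0
  then show ?case by (auto intro: continuous_on_eq)
next
  case (Suc k)
  have "g differentiable (at x)" "frechet_derivative g (at x) = frechet_derivative f (at x)"
    if "x \<in> S" for x
  proof -
    have "(g has_derivative frechet_derivative f (at x)) (at x)"
      by (rule has_derivative_transform_within_open[where f = f, OF _ \<open>open S\<close> that])
         (use Suc.prems that in \<open>auto simp: frechet_derivative_works\<close>)
    then show "g differentiable (at x)" "frechet_derivative g (at x) = frechet_derivative f (at x)"
      by (auto simp: differentiable_def dest: frechet_derivative_at)
  qed
  note g = this
  have "Ck_on k (\<lambda>x. frechet_derivative g (at x) v) S" for v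
    by (rule Suc.IH[of "\<lambda>x. frechet_derivative f (at x) v"]) (use Suc.prems(2) g(2) in simp_all)
  then show ?case
    using g(1) by simp
qed

lemma Ck_on_cong:
  assumes "open S" "\<And>x. x \<in> S \<Longrightarrow> f x = g x"
  shows "Ck_on k f S \<longleftrightarrow> Ck_on k g S"
  using Ck_on_cong_imp[OF assms(1), of f g] Ck_on_cong_imp[OF assms(1), of g f] assms(2) by auto

text \<open>Uniqueness of the derivative lets an explicit formula \<open>f'\<close> replace
  \<open>frechet_derivative\<close>. This is the introduction rule for the inductions below: find
  the derivative, then recognise it as C^k.\<close>

lemma Ck_on_Suc_has_derivative:
  assumes "\<And>x. x \<in> S \<Longrightarrow> (f has_derivative f' x) (at x)"
    and "\<And>v. Ck_on k (\<lambda>x. f' x v) S" and "open S"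
  shows "Ck_on (Suc k) f S"
proof -
  have "frechet_derivative f (at x) = f' x" if "x \<in> S" for x
    using frechet_derivative_at[OF assms(1)[OF that]] by simp
  then have "Ck_on k (\<lambda>x. frechet_derivative f (at x) v) S" for v
    by (intro Ck_on_cong_imp[OF assms(3) _ assms(2)[of v]]) simp
  then show ?thesis
    using assms(1) by (auto simp: differentiable_def)
qed

lemma Ck_on_SucD_has_derivative:
  "Ck_on (Suc k) f S \<Longrightarrow> x \<in> S \<Longrightarrow> (f has_derivative frechet_derivative f (at x)) (at x)"
  by (simp add: frechet_derivative_works)

lemma Ck_on_Suc_imp: "Ck_on (Suc k) f S \<Longrightarrow> Ck_on k f S"
proof (induction k arbitrary: f)
  case 0
  then show ?case
    by (auto intro!: continuous_at_imp_continuous_on differentiable_imp_continuous_within)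
qed (simp; blast)

text \<open>Being C^k is a local condition at every level of the recursion. It serves to glue a
  function defined on a chart to the zero function.\<close>

lemma Ck_on_local:
  assumes "\<And>x. x \<in> S \<Longrightarrow> \<exists>T. open T \<and> x \<in> T \<and> Ck_on k f T"
  shows "Ck_on k f S"
  using assms
proof (induction k arbitrary: f)
  case 0
  then show ?case
    by (auto intro!: continuous_at_imp_continuous_on simp: continuous_on_eq_continuous_at)
      (metis continuous_on_eq_continuous_at)
next
  case (Suc k)
  have "Ck_on k (\<lambda>x. frechet_derivative f (at x) v) S" for v
    by (rule Suc.IH) (use Suc.prems in fastforce)
  then show ?case using Suc.prems by fastforce
qed

lemma Ck_on_bounded_linear:
  assumes "bounded_linear L" "open S" "Ck_on k f S"
  shows "Ck_on k (\<lambda>x. L (f x)) S"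
  using assms(3)
proof (induction k arbitrary: f)
  case 0
  then show ?case
    by (simp add: bounded_linear.continuous_on[OF assms(1)])
next
  case (Suc k)
  show ?case
    using Suc.prems Suc.IH
    by (intro Ck_on_Suc_has_derivative[OF bounded_linear.has_derivative[OF assms(1)
          Ck_on_SucD_has_derivative[OF Suc.prems]]] assms(2)) auto
qed

lemma Ck_on_const: "open S \<Longrightarrow> Ck_on k (\<lambda>_. c) S"
proof (induction k arbitrary: c)
  case (Suc k)
  then show ?case by (intro Ck_on_Suc_has_derivative[OF has_derivative_const]) auto
qed auto

lemma Ck_on_id: "open S \<Longrightarrow> Ck_on k (\<lambda>x. x) S"
  by (cases k) (auto intro!: Ck_on_Suc_has_derivative[OF has_derivative_ident] Ck_on_const continuous_intros
    simp del: Ck_on.simps(2))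

lemma Ck_on_add:
  assumes "open S" "Ck_on k f S" "Ck_on k g S"
  shows "Ck_on k (\<lambda>x. f x + g x) S"
  using assms(2,3)
proof (induction k arbitrary: f g)
  case (Suc k)
  show ?case
    using Suc.prems Suc.IH
    by (intro Ck_on_Suc_has_derivative[OF has_derivative_add[OF
        Ck_on_SucD_has_derivative[OF Suc.prems(1)] Ck_on_SucD_has_derivative[OF Suc.prems(2)]]] assms(1)) auto
qed (auto intro: continuous_intros)

lemma Ck_on_minus: "open S \<Longrightarrow> Ck_on k f S \<Longrightarrow> Ck_on k (\<lambda>x. - f x) S"
  by (rule Ck_on_bounded_linear[OF bounded_linear_minus[OF bounded_linear_ident]])

lemma Ck_on_diff:
  "open S \<Longrightarrow> Ck_on k f S \<Longrightarrow> Ck_on k g S \<Longrightarrow> Ck_on k (\<lambda>x. f x - g x) S"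
  using Ck_on_add[of S k f "\<lambda>x. - g x"] Ck_on_minus[of S k g] by simp

lemma Ck_on_sum:
  "open S \<Longrightarrow> (\<And>i. i \<in> I \<Longrightarrow> Ck_on k (f i) S) \<Longrightarrow> Ck_on k (\<lambda>x. \<Sum>i\<in>I. f i x) S"
  by (induction I rule: infinite_finite_induct) (auto intro: Ck_on_const Ck_on_add)

text \<open>The product rule yields two terms of the same bilinear shape, each with one factor
  differentiated and the other lowered to C^k, so the induction closes. Products, scalar multiples
  and inner products are instances.\<close>

lemma Ck_on_bilinear:
  assumes "bounded_bilinear B" "open S" "Ck_on k f S" "Ck_on k g S"
  shows "Ck_on k (\<lambda>x. B (f x) (g x)) S"
  using assms(3,4)
proof (induction k arbitrary: f g)
  case 0
  then show ?case by (simp add: bounded_bilinear.continuous_on[OF assms(1)])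
next
  case (Suc k)
  note D = Ck_on_SucD_has_derivative
  have "Ck_on k f S" "Ck_on k g S"
    using Suc.prems by (auto dest!: Ck_on_Suc_imp simp del: Ck_on.simps)
  then have "Ck_on k (\<lambda>x. B (f x) (frechet_derivative g (at x) v) + B (frechet_derivative f (at x) v) (g x)) S" for v
    using Suc by (intro Ck_on_add assms(2) Suc.IH) auto
  then show ?case
    by (intro Ck_on_Suc_has_derivative[OF bounded_bilinear.FDERIV[OF assms(1) D[OF Suc.prems(1)] D[OF Suc.prems(2)]]] assms(2))
qed

lemmas Ck_on_mult = Ck_on_bilinear[OF bounded_bilinear_mult]
lemmas Ck_on_scaleR = Ck_on_bilinear[OF bounded_bilinear_scaleR]
lemmas Ck_on_inner = Ck_on_bilinear[OF bounded_bilinear_inner]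
lemmas Ck_on_vec_nth = Ck_on_bounded_linear[OF bounded_linear_vec_nth]

lemma Ck_on_matrix_vector:
  fixes M :: "'a::real_normed_vector \<Rightarrow> real^'n^'m"
  assumes "open S" "Ck_on k M S" "Ck_on k v S"
  shows "Ck_on k (\<lambda>x. M x *v v x) S"
proof -
  have "M x *v v x = (\<Sum>i\<in>UNIV. (M x $ i \<bullet> v x) *\<^sub>R axis i 1)" for x
    by (simp add: vec_eq_iff matrix_vector_mult_def inner_vec_def axis_def if_distrib cong: if_cong)
  then show ?thesis
    using assms by (auto intro!: Ck_on_sum Ck_on_scaleR Ck_on_inner Ck_on_vec_nth Ck_on_const)
qed

lemma linear_expand_Basis:
  fixes L :: "'a::euclidean_space \<Rightarrow> 'b::real_vector"
  assumes "linear L"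
  shows "L v = (\<Sum>b\<in>Basis. (v \<bullet> b) *\<^sub>R L b)"
  using assms by (metis (no_types, lifting) euclidean_representation linear_cmul linear_sum sum.cong)

text \<open>\<open>Ck_on\<close> controls derivatives in fixed directions only, while the chain rule
  and vector fields produce directions \<open>w x\<close> that move with the point. Expanding
  \<open>w x\<close> in the finite basis reduces the second case to the first.\<close>

lemma Ck_on_apply_derivative:
  fixes g :: "'b::euclidean_space \<Rightarrow> 'c::real_normed_vector"
  assumes S: "open S"
    and D: "\<And>b. b \<in> Basis \<Longrightarrow> Ck_on k (\<lambda>x. frechet_derivative g (at (f x)) b) S"
    and diff: "\<And>x. x \<in> S \<Longrightarrow> g differentiable at (f x)"
    and w: "Ck_on k w S"
  shows "Ck_on k (\<lambda>x. frechet_derivative g (at (f x)) (w x)) S"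
proof -
  have "frechet_derivative g (at (f x)) (w x)
      = (\<Sum>b\<in>Basis. (w x \<bullet> b) *\<^sub>R frechet_derivative g (at (f x)) b)" if "x \<in> S" for x
    using diff[OF that] by (intro linear_expand_Basis linear_frechet_derivative)
  moreover have "Ck_on k (\<lambda>x. \<Sum>b\<in>Basis. (w x \<bullet> b) *\<^sub>R frechet_derivative g (at (f x)) b) S"
    by (intro Ck_on_sum Ck_on_scaleR Ck_on_inner Ck_on_const S w D)
  ultimately show ?thesis by (subst Ck_on_cong[OF S])
qed

text \<open>Induction over the order with \<open>g\<close> varying: the chain rule leaves the
  derivative of \<open>g\<close> along f, which is a composition one order lower, applied to a
  moving direction.\<close>

lemma Ck_on_compose:
  fixes f :: "'a::real_normed_vector \<Rightarrow> 'b::euclidean_space"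
  assumes "open S" "Ck_on k f S" "Ck_on k g T" "f ` S \<subseteq> T"
  shows "Ck_on k (\<lambda>x. g (f x)) S"
  using assms(2,3)
proof (induction k arbitrary: g)
  case 0
  then show ?case using assms(4) by (auto intro: continuous_on_compose2)
next
  case (Suc k)
  have f: "Ck_on k f S" using Suc.prems(1) by (rule Ck_on_Suc_imp)
  have "((\<lambda>x. g (f x)) has_derivative
     (\<lambda>v. frechet_derivative g (at (f x)) (frechet_derivative f (at x) v))) (at x)" if "x \<in> S" for x
    using diff_chain_at[of f _ x g] Ck_on_SucD_has_derivative[OF Suc.prems(1) that]
      Ck_on_SucD_has_derivative[OF Suc.prems(2)] that assms(4)
    by (auto simp: o_def)
  moreover have "Ck_on k (\<lambda>x. frechet_derivative g (at (f x)) (frechet_derivative f (at x) v)) S" for v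
  proof (rule Ck_on_apply_derivative[OF assms(1)])
    show "Ck_on k (\<lambda>x. frechet_derivative g (at (f x)) b) S" for b
      using Suc.IH[OF f, of "\<lambda>x. frechet_derivative g (at x) b"] Suc.prems(2) by simp
  qed (use Suc.prems assms(4) in auto)
  ultimately show ?case by (intro Ck_on_Suc_has_derivative assms(1))
qed

text \<open>With u(x) = 1/sqrt x the derivative is -u^3/2, a polynomial in u itself, so C^k of u
  gives C^(k+1). It is the normalising factor both for Gram-Schmidt and for the cutoffs.\<close>

lemma Ck_on_inverse_sqrt: "Ck_on k (\<lambda>x::real. inverse (sqrt x)) {0<..}"
proof (induction k)
  case 0
  then show ?case by (auto intro!: continuous_intros)
next
  case (Suc k)
  let ?u = "\<lambda>x::real. inverse (sqrt x)"
  have "(?u has_derivative (\<lambda>v. v * (- (1/2) * (?u x * (?u x * ?u x))))) (at x)" if "x \<in> {0<..}" for x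
    using that by (auto intro!: derivative_eq_intros simp: field_simps)
  moreover have "Ck_on k (\<lambda>x. v * (- (1/2) * (?u x * (?u x * ?u x)))) {0<..}" for v
    using Suc by (intro Ck_on_mult Ck_on_const) auto
  ultimately show ?case by (intro Ck_on_Suc_has_derivative) auto
qed

lemma Ck_on_prod:
  fixes f :: "'i \<Rightarrow> 'a::real_normed_vector \<Rightarrow> real"
  shows "open S \<Longrightarrow> (\<And>i. i \<in> I \<Longrightarrow> Ck_on k (f i) S) \<Longrightarrow> Ck_on k (\<lambda>x. \<Prod>i\<in>I. f i x) S"
  by (induction I rule: infinite_finite_induct) (auto intro: Ck_on_const Ck_on_mult)

lemma Ck_on_det:
  fixes M :: "'a::real_normed_vector \<Rightarrow> real^'n^'n"
  assumes "open S" "Ck_on k M S"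
  shows "Ck_on k (\<lambda>x. det (M x)) S"
  unfolding det_def using assms
  by (intro Ck_on_sum Ck_on_mult Ck_on_const Ck_on_prod Ck_on_vec_nth)

text \<open>The family is closed under differentiation, which makes smoothness an easy induction.\<close>

definition flat_quot :: "nat \<Rightarrow> real \<Rightarrow> real" where
  "flat_quot n t = (if t > 0 then exp (- inverse t) / t ^ n else 0)"

text \<open>From the right, the substitution s = 1/t turns the quotient into s^n / exp s with s
  tending to infinity; from the left it is constantly 0.\<close>

lemma flat_quot_tendsto: "(flat_quot n \<longlongrightarrow> 0) (at 0)"
proof -
  have "((\<lambda>t::real. exp (- inverse t) / t ^ n) \<longlongrightarrow> 0) (at_right 0)"
    using filterlim_compose[OF tendsto_power_div_exp_0[of n] filterlim_inverse_at_top_right]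
    by (simp add: exp_minus divide_inverse mult.commute power_inverse)
  moreover have "\<forall>\<^sub>F t::real in at_right 0. exp (- inverse t) / t ^ n = flat_quot n t"
    using eventually_at_right_less[of "0::real"] by eventually_elim (auto simp: flat_quot_def)
  moreover have "\<forall>\<^sub>F t in at_left 0. flat_quot n t = 0"
    by (auto simp: flat_quot_def eventually_at_filter)
  ultimately show ?thesis
    by (auto simp: filterlim_at_split tendsto_cong intro: Lim_transform_eventually tendsto_eventually)
qed

lemma flat_quot_deriv:
  "(flat_quot n has_real_derivative flat_quot (n + 2) t - real n * flat_quot (n + 1) t) (at t)"
proof -
  consider "t < 0" | "t = 0" | "t > 0" by linarith
  then show ?thesis
  proof cases
    case 1
    then show ?thesis
      using has_field_derivative_transform_within_open[where f = "\<lambda>_. 0", OF DERIV_const open_lessThan[of 0],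
          of t "flat_quot n"]
      by (auto simp: flat_quot_def)
  next
    case 2
    \<comment> \<open>The difference quotient at 0 is again a member of the family, with exponent
      one higher, so its limit 0 is already known.\<close>
    have "(\<lambda>y. (flat_quot n y - flat_quot n 0) / (y - 0)) = flat_quot (n + 1)"
      by (auto simp: flat_quot_def fun_eq_iff)
    then show ?thesis
      using flat_quot_tendsto[of "n+1"] 2 by (simp add: has_field_derivative_iff flat_quot_def[of _ 0])
  next
    case 3
    have "((\<lambda>t. exp (- inverse t) / t ^ n) has_real_derivative
        flat_quot (n + 2) t - real n * flat_quot (n + 1) t) (at t)"
      using 3
      by (cases n) (auto intro!: derivative_eq_intros simp: flat_quot_def field_simps power2_eq_square,
        metis One_nat_def power_eq_if)
    then show ?thesis
      by (rule has_field_derivative_transform_within_open[where f = "\<lambda>t. exp (- inverse t) / t ^ n", OF _ open_greaterThan[of 0]])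
         (use 3 in \<open>auto simp: flat_quot_def\<close>)
  qed
qed

lemma Ck_on_flat_quot: "Ck_on k (flat_quot n) UNIV"
proof (induction k arbitrary: n)
  case 0
  then show ?case
    by (auto intro!: continuous_at_imp_continuous_on DERIV_isCont[OF flat_quot_deriv])
next
  case (Suc k)
  have "Ck_on k (\<lambda>x. (flat_quot (n + 2) x - real n * flat_quot (n + 1) x) * v) UNIV" for v
    using Suc by (intro Ck_on_mult Ck_on_const Ck_on_diff) auto
  then show ?case
    using flat_quot_deriv by (intro Ck_on_Suc_has_derivative) (auto simp: has_field_derivative_def)
qed

section \<open>Orthonormal frames of matrix fields\<close>

text \<open>Gram-Schmidt is run for all points x at once. Each step uses only sums, products and
  \<open>inverse (sqrt (q x))\<close> with \<open>q x > 0\<close>, hence preserves smoothness. The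
  induction over the set I of treated coordinates also carries that components outside I vanish,
  which keeps the next coordinate vector independent of the earlier ones.\<close>

lemma smooth_orthonormal_frame:
  fixes G :: "'a::real_normed_vector \<Rightarrow> real^'d^'d"
  assumes U: "open U" and G: "smooth_on G U"
    and sym: "\<And>x v w. x \<in> U \<Longrightarrow> v \<bullet> (G x *v w) = w \<bullet> (G x *v v)"
    and pos: "\<And>x v. x \<in> U \<Longrightarrow> v \<noteq> 0 \<Longrightarrow> v \<bullet> (G x *v v) > 0"
  obtains e :: "'d \<Rightarrow> 'a \<Rightarrow> real^'d" where
    "\<And>i. smooth_on (e i) U"
    "\<And>x i j. x \<in> U \<Longrightarrow> e i x \<bullet> (G x *v e j x) = (if i = j then 1 else 0)"
proof -
  have "\<exists>e :: 'd \<Rightarrow> 'a \<Rightarrow> real^'d. (\<forall>i\<in>I. smooth_on (e i) U) \<and>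
     (\<forall>x\<in>U. \<forall>i\<in>I. (\<forall>j. j \<notin> I \<longrightarrow> e i x $ j = 0) \<and>
       (\<forall>j\<in>I. e i x \<bullet> (G x *v e j x) = (if i = j then 1 else 0)))" for I
    using finite[of I]
  proof (induction I rule: finite_induct)
    case empty
    then show ?case by simp
  next
    case (insert i I)
    then obtain e :: "'d \<Rightarrow> 'a \<Rightarrow> real^'d" where e: "\<And>k. k \<in> I \<Longrightarrow> smooth_on (e k) U"
      "\<And>x k j. x \<in> U \<Longrightarrow> k \<in> I \<Longrightarrow> j \<notin> I \<Longrightarrow> e k x $ j = 0"
      "\<And>x k j. x \<in> U \<Longrightarrow> k \<in> I \<Longrightarrow> j \<in> I \<Longrightarrow> e k x \<bullet> (G x *v e j x) = (if k = j then 1 else 0)"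
      by blast
    \<comment> \<open>Coordinate \<open>i\<close> of the vectors found so far vanishes, so the Gram-Schmidt remainder \<open>w\<close> is nonzero.\<close>
    define w where "w = (\<lambda>x. axis i 1 - (\<Sum>k\<in>I. (axis i 1 \<bullet> (G x *v e k x)) *\<^sub>R e k x))"
    define q where "q = (\<lambda>x. w x \<bullet> (G x *v w x))"
    define n where "n = (\<lambda>x. inverse (sqrt (q x)) *\<^sub>R w x)"
    have sm_w: "Ck_on k w U" for k
      unfolding w_def using e(1) G U
      by (auto intro!: Ck_on_diff Ck_on_sum Ck_on_scaleR Ck_on_inner Ck_on_matrix_vector Ck_on_const
          simp: smooth_on_def)
    have sm_q: "Ck_on k q U" for k
      unfolding q_def using sm_w G U by (auto intro!: Ck_on_inner Ck_on_matrix_vector simp: smooth_on_def)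
    have "w x $ i = 1" if "x \<in> U" for x
      using e(2)[OF that] insert.hyps(2) by (simp add: w_def)
    then have w0: "w x \<noteq> 0" if "x \<in> U" for x
      using that by (metis zero_index zero_neq_one)
    have q: "q x > 0" if "x \<in> U" for x using pos[OF that w0[OF that]] by (simp add: q_def)
    have wi: "w x \<bullet> (G x *v e j x) = 0" if "x \<in> U" "j \<in> I" for x j
    proof -
      have "(\<Sum>k\<in>I. (axis i 1 \<bullet> (G x *v e k x)) * (e k x \<bullet> (G x *v e j x)))
          = (\<Sum>k\<in>I. if k = j then axis i 1 \<bullet> (G x *v e k x) else 0)"
        using that e(3) by (intro sum.cong) auto
      then show ?thesis
        using that insert.hyps(1) by (simp add: w_def inner_diff_left inner_sum_left)
    qed
    have ni: "n x \<bullet> (G x *v e j x) = 0" if "x \<in> U" "j \<in> I" for x j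
      using wi[OF that] by (simp add: n_def)
    then have ni': "e j x \<bullet> (G x *v n x) = 0" if "x \<in> U" "j \<in> I" for x j
      using that sym by metis
    have nn: "n x \<bullet> (G x *v n x) = 1" if "x \<in> U" for x
    proof -
      have "w x \<bullet> (G x *v w x) = q x" by (simp add: q_def)
      then show ?thesis
        using q[OF that] by (simp add: n_def matrix_vector_mult_scaleR field_simps)
    qed
    have "w x $ j = 0" if "x \<in> U" "j \<notin> insert i I" for x j
      using that e(2) by (auto simp: w_def axis_def)
    then have nz: "n x $ j = 0" if "x \<in> U" "j \<notin> insert i I" for x j
      using that by (simp add: n_def)
    have "smooth_on n U"
      unfolding smooth_on_def n_def using q
      by (auto intro!: Ck_on_scaleR U sm_w Ck_on_compose[OF U sm_q Ck_on_inverse_sqrt])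
    then show ?case
      using e ni ni' nn nz insert.hyps by (intro exI[of _ "e(i := n)"]) (auto simp: insert_iff)
  qed
  from this[of UNIV] obtain e :: "'d \<Rightarrow> 'a \<Rightarrow> real^'d" where
    "\<forall>i. smooth_on (e i) U" "\<forall>x\<in>U. \<forall>i j. e i x \<bullet> (G x *v e j x) = (if i = j then 1 else 0)"
    by auto
  then show ?thesis using that[of e] by simp
qed

section \<open>Linear algebra of positive definite matrices\<close>

lemma orthonormal_frame_matrix:
  fixes G :: "real^'d^'d" and e :: "'d \<Rightarrow> real^'d"
  assumes "\<And>i j. e i \<bullet> (G *v e j) = (if i = j then 1 else 0)"
  shows "((\<chi> i. e i) ** G) ** transpose (\<chi> i. e i) = mat 1"
proof -
  have "((\<chi> i. e i) ** G) ** transpose (\<chi> i. e i) = (\<chi> i. e i) ** (G ** transpose (\<chi> i. e i))"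
    by (simp add: matrix_mul_assoc)
  also have "\<dots> = (\<chi> i j. e i \<bullet> (G *v e j))"
    by (simp add: vec_eq_iff matrix_matrix_mult_def matrix_vector_mult_def inner_vec_def transpose_def)
  finally show ?thesis by (simp add: assms mat_def)
qed

text \<open>Let E have the rows e_i. Then E G E^T = 1 says that E^T is a right inverse of E G; for
  square matrices it is also a left inverse, and E^T (E G) = 1 applied to w is the
  expansion.\<close>

lemma orthonormal_expansion:
  fixes G :: "real^'d^'d" and e :: "'d \<Rightarrow> real^'d"
  assumes "\<And>i j. e i \<bullet> (G *v e j) = (if i = j then 1 else 0)"
    and sym: "\<And>v w. v \<bullet> (G *v w) = w \<bullet> (G *v v)"
  shows "(\<Sum>k\<in>UNIV. (w \<bullet> (G *v e k)) *\<^sub>R e k) = w"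
proof -
  let ?E = "\<chi> i. e i"
  have "transpose ?E ** (?E ** G) = mat 1"
    using orthonormal_frame_matrix[OF assms(1)] by (simp add: matrix_left_right_inverse)
  then have "w = transpose ?E *v (?E *v (G *v w))"
    by (simp add: matrix_vector_mul_assoc)
  also have "\<dots> = (\<Sum>k\<in>UNIV. (e k \<bullet> (G *v w)) *\<^sub>R e k)"
    by (simp add: vec_eq_iff matrix_vector_mult_def inner_vec_def transpose_def mult.commute)
  finally show ?thesis using sym[of w] by simp
qed

text \<open>Taking determinants in E G E^T = 1 gives (det E)^2 det G = 1. Positivity is what makes
  the density \<open>sqrt (det G)\<close> differentiable and nonzero.\<close>

lemma det_pos_definite:
  fixes G :: "real^'d^'d"
  assumes sym: "\<And>v w. v \<bullet> (G *v w) = w \<bullet> (G *v v)"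
    and pos: "\<And>v. v \<noteq> 0 \<Longrightarrow> v \<bullet> (G *v v) > 0"
  shows "det G > 0"
proof -
  \<comment> \<open>A single matrix is treated as a constant field over the real line, to be
    evaluated at 0.\<close>
  obtain e :: "'d \<Rightarrow> real \<Rightarrow> real^'d" where
    "\<And>x i j. x \<in> UNIV \<Longrightarrow> e i x \<bullet> (G *v e j x) = (if i = j then 1 else 0)"
  proof (rule smooth_orthonormal_frame[of "UNIV :: real set" "\<lambda>_. G"])
    show "smooth_on (\<lambda>_::real. G) UNIV" by (simp add: smooth_on_def Ck_on_const)
  qed (use sym pos in blast)+
  then have "((\<chi> i. e i 0) ** G) ** transpose (\<chi> i. e i 0) = mat 1"
    by (intro orthonormal_frame_matrix) simp
  then have "det (\<chi> i. e i 0) * det G * det (\<chi> i. e i 0) = 1"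
    by (metis det_I det_mul det_transpose)
  then have "(det (\<chi> i. e i 0))\<^sup>2 * det G = 1"
    by (simp add: power2_eq_square ac_simps)
  then show ?thesis
    by (metis zero_less_mult_pos zero_less_one zero_less_power2 mult_zero_left power_zero_numeral zero_neq_one)
qed

section \<open>Charts and tangent vectors\<close>

locale manifold =
  fixes X :: "'m topology" and A :: "('m, 'd::finite) chart set"
  assumes smooth_manifold: "smooth_manifold X A"
begin

lemma Hausdorff: "Hausdorff_space X"
  using smooth_manifold by (simp add: smooth_manifold_def)

lemma
  assumes "c \<in> A"
  shows openin_cdom: "openin X (cdom c)" and open_cimg: "open (cimg c)"
    and homeomorphic_cmap: "homeomorphic_map (subtopology X (cdom c)) (top_of_set (cimg c)) (cmap c)"
    and cdom_subset: "cdom c \<subseteq> topspace X"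
proof -
  show "openin X (cdom c)" "open (cimg c)"
    "homeomorphic_map (subtopology X (cdom c)) (top_of_set (cimg c)) (cmap c)"
    using assms smooth_manifold by (auto simp: smooth_manifold_def is_chart_def)
  then show "cdom c \<subseteq> topspace X" by (simp add: openin_subset)
qed

lemma inj_on_cmap: "c \<in> A \<Longrightarrow> inj_on (cmap c) (cdom c)"
  using homeomorphic_imp_injective_map[OF homeomorphic_cmap, of c] cdom_subset[of c]
  by (simp add: Int_absorb1)

lemma cinv_cmap [simp]: "c \<in> A \<Longrightarrow> p \<in> cdom c \<Longrightarrow> cinv c (cmap c p) = p"
  by (simp add: inj_on_cmap)

lemma cmap_cinv [simp]: "x \<in> cimg c \<Longrightarrow> cmap c (cinv c x) = x"
  by (simp add: f_inv_into_f)

lemma cinv_in_cdom: "x \<in> cimg c \<Longrightarrow> cinv c x \<in> cdom c"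
  by (simp add: inv_into_into)

lemma ex_chart: "p \<in> topspace X \<Longrightarrow> \<exists>c\<in>A. p \<in> cdom c"
proof -
  have "(\<Union>c\<in>A. cdom c) = topspace X"
    using smooth_manifold unfolding smooth_manifold_def by (elim conjE)
  then show "p \<in> topspace X \<Longrightarrow> \<exists>c\<in>A. p \<in> cdom c" by blast
qed

lemma
  assumes "p \<in> topspace X"
  shows chart_at_in: "chart_at A p \<in> A" and in_chart_at: "p \<in> cdom (chart_at A p)"
proof -
  have "chart_at A p \<in> A \<and> p \<in> cdom (chart_at A p)"
    unfolding chart_at_def by (rule someI_ex) (use ex_chart[OF assms] in blast)
  then show "chart_at A p \<in> A" "p \<in> cdom (chart_at A p)" by blast+
qed

lemma open_cmap_image:
  assumes "c \<in> A" "openin X V"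
  shows "open (cmap c ` (cdom c \<inter> V))"
proof -
  have "openin (subtopology X (cdom c)) (cdom c \<inter> V)"
    using assms(2) by (simp add: openin_subtopology_Int2)
  then have "openin (top_of_set (cimg c)) (cmap c ` (cdom c \<inter> V))"
    using homeomorphic_imp_open_map[OF homeomorphic_cmap[OF assms(1)]] by (simp add: open_map_def)
  then show ?thesis using open_cimg[OF assms(1)] by (rule openin_open_trans)
qed

lemma open_overlap: "c \<in> A \<Longrightarrow> c' \<in> A \<Longrightarrow> open (cmap c ` (cdom c \<inter> cdom c'))"
  by (intro open_cmap_image openin_cdom)

text \<open>The image is compact, and compact sets in a Hausdorff space are closed. Closedness in
  all of X, and not merely inside the chart, is what permits extension by zero beyond the
  chart.\<close>

lemma closedin_cinv_image:
  assumes "c \<in> A" "compact K" "K \<subseteq> cimg c"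
  shows "closedin X (cinv c ` K)"
proof -
  obtain g where g: "homeomorphic_maps (subtopology X (cdom c)) (top_of_set (cimg c)) (cmap c) g"
    using homeomorphic_cmap[OF assms(1)] by (auto simp: homeomorphic_map_maps)
  then have "continuous_map (top_of_set (cimg c)) (subtopology X (cdom c)) g"
    by (simp add: homeomorphic_maps_def)
  moreover have "compactin (top_of_set (cimg c)) K"
    using assms by (simp add: compactin_subtopology)
  ultimately have "compactin (subtopology X (cdom c)) (g ` K)"
    by (rule image_compactin[rotated])
  \<comment> \<open>Continuity is known for the inverse \<open>g\<close> supplied by the
    homeomorphism; it has to be identified with \<open>cinv c\<close> on K.\<close>
  moreover have "g x = cinv c x" if "x \<in> K" for x
  proof -
    obtain q where q: "q \<in> cdom c" "x = cmap c q" using \<open>x \<in> K\<close> assms(3) by blast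
    then have "q \<in> topspace (subtopology X (cdom c))" using cdom_subset[OF assms(1)] by auto
    then have "g (cmap c q) = q" using g by (simp add: homeomorphic_maps_def)
    then show ?thesis using q assms(1) by simp
  qed
  ultimately have "compactin X (cinv c ` K)"
    by (simp add: compactin_subtopology cong: image_cong_simp)
  then show ?thesis using Hausdorff compactin_imp_closedin by blast
qed

section \<open>Change of charts and tangent vectors\<close>

lemma Ck_on_transition:
  assumes "c \<in> A" "c' \<in> A"
  shows "Ck_on k (transition c c') (cmap c ` (cdom c \<inter> cdom c'))"
  using smooth_manifold assms
  by (auto simp: smooth_manifold_def smoothly_compatible_def smooth_on_def)

lemma transition_cmap [simp]:
  "c \<in> A \<Longrightarrow> p \<in> cdom c \<Longrightarrow> transition c c' (cmap c p) = cmap c' p"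
  by (simp add: transition_def)

lemma has_derivative_transition:
  assumes "c \<in> A" "c' \<in> A" "p \<in> cdom c" "p \<in> cdom c'"
  shows "(transition c c' has_derivative transition_deriv c c' p) (at (cmap c p))"
  unfolding transition_deriv_def
  by (rule Ck_on_SucD_has_derivative[OF Ck_on_transition]) (use assms in auto)

lemma linear_transition_deriv:
  assumes "c \<in> A" "c' \<in> A" "p \<in> cdom c" "p \<in> cdom c'"
  shows "linear (transition_deriv c c' p)"
  using has_derivative_transition[OF assms] by (rule has_derivative_linear)

text \<open>On the overlap, \<open>f \<circ> cinv c\<close> is \<open>f \<circ> cinv c'\<close>
  after the transition map, so this is the chain rule. The codomain of \<open>f\<close> is left
  arbitrary so that \<open>f\<close> may itself be a chart map.\<close>

lemma has_derivative_change_chart: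
  assumes "c \<in> A" "c' \<in> A" "p \<in> cdom c" "p \<in> cdom c'"
    and "((f \<circ> cinv c') has_derivative L) (at (cmap c' p))"
  shows "((f \<circ> cinv c) has_derivative (\<lambda>v. L (transition_deriv c c' p v))) (at (cmap c p))"
proof (rule has_derivative_transform_within_open[where f = "\<lambda>x. (f \<circ> cinv c') (transition c c' x)"])
  show "((\<lambda>x. (f \<circ> cinv c') (transition c c' x)) has_derivative (\<lambda>v. L (transition_deriv c c' p v)))
      (at (cmap c p))"
    using diff_chain_at[OF has_derivative_transition[OF assms(1-4)], of "f \<circ> cinv c'" L] assms
    by (simp add: o_def)
  show "open (cmap c ` (cdom c \<inter> cdom c'))" using assms by (intro open_overlap)
qed (use assms in auto)

text \<open>The cocycle rule: change of chart applied to \<open>f = cmap c''\<close>, whose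
  coordinate expressions are transition maps, and uniqueness of derivatives.\<close>

lemma transition_deriv_comp:
  assumes "c \<in> A" "c' \<in> A" "c'' \<in> A" "p \<in> cdom c" "p \<in> cdom c'" "p \<in> cdom c''"
  shows "transition_deriv c' c'' p (transition_deriv c c' p v) = transition_deriv c c'' p v"
  using has_derivative_change_chart[OF assms(1,2,4,5), of "cmap c''" "transition_deriv c' c'' p"]
    has_derivative_transition[OF assms(2,3,5,6)] has_derivative_transition[OF assms(1,3,4,6)]
    has_derivative_unique[of "transition c c''"]
  by (simp add: transition_def fun_eq_iff) (metis)

lemma transition_deriv_self [simp]:
  assumes "c \<in> A" "p \<in> cdom c"
  shows "transition_deriv c c p v = v"
proof -
  have "(transition c c has_derivative (\<lambda>v. v)) (at (cmap c p))"
    by (rule has_derivative_transform_within_open[where f = "\<lambda>x. x", OF _ open_cimg[OF assms(1)]])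
      (use assms in \<open>auto simp: transition_def\<close>)
  then show ?thesis
    using has_derivative_unique[OF has_derivative_transition[OF assms(1,1,2,2)]] by metis
qed

text \<open>The tangent vector at p whose components in chart \<open>c\<close> are \<open>v\<close>;
  for p in \<open>c\<close>, it inverts reading off the component \<open>w c\<close>. The value 0 at
  the remaining charts is prescribed by \<open>tangent_space\<close>.\<close>

definition tangent_of :: "('m, 'd) chart \<Rightarrow> 'm \<Rightarrow> real^'d \<Rightarrow> ('m, 'd) tangent" where
  "tangent_of c p v = (\<lambda>c'. if c' \<in> A \<and> p \<in> cdom c' then transition_deriv c c' p v else 0)"

lemma coord_vector_eq: "coord_vector A c p i = tangent_of c p (axis i 1)"
  by (simp add: coord_vector_def tangent_of_def)

lemma tangent_of_in:
  assumes "c \<in> A" "p \<in> cdom c"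
  shows "tangent_of c p v \<in> tangent_space A p"
  using assms by (auto simp: tangent_space_def tangent_of_def transition_deriv_comp)

lemma tangent_of_self [simp]: "c \<in> A \<Longrightarrow> p \<in> cdom c \<Longrightarrow> tangent_of c p v c = v"
  by (simp add: tangent_of_def)

lemma transition_deriv_component:
  assumes "w \<in> tangent_space A p" "c \<in> A" "c' \<in> A" "p \<in> cdom c" "p \<in> cdom c'"
  shows "transition_deriv c c' p (w c) = w c'"
proof -
  have "w c' = transition_deriv c c' p (w c)"
    using assms unfolding tangent_space_def by blast
  then show ?thesis by (rule sym)
qed

lemma tangent_component_zero: "w \<in> tangent_space A p \<Longrightarrow> \<not> (c \<in> A \<and> p \<in> cdom c) \<Longrightarrow> w c = 0"
  unfolding tangent_space_def by blast

lemma tangent_of_component: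
  assumes "w \<in> tangent_space A p" "c \<in> A" "p \<in> cdom c"
  shows "tangent_of c p (w c) = w"
  using assms by (auto simp: tangent_of_def transition_deriv_component tangent_component_zero)

lemma tangent_of_linear_comb:
  assumes "c \<in> A" "p \<in> cdom c"
  shows "tangent_of c p (r *\<^sub>R u + s *\<^sub>R v) = (\<lambda>c'. r *\<^sub>R tangent_of c p u c' + s *\<^sub>R tangent_of c p v c')"
  using assms linear_transition_deriv[OF assms(1) _ assms(2)]
  by (auto simp: tangent_of_def fun_eq_iff linear_add linear_scale)

lemma tangent_space_eqI:
  assumes "v \<in> tangent_space A p" "w \<in> tangent_space A p" "c \<in> A" "p \<in> cdom c" "v c = w c"
  shows "v = w"
  using tangent_of_component assms by metis

lemma zero_in_tangent_space: "(\<lambda>_. 0) \<in> tangent_space A p"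
  using linear_transition_deriv[of _ _ p] by (auto simp: tangent_space_def linear_0)

lemma tangent_space_sum:
  assumes "\<And>j. j \<in> J \<Longrightarrow> u j \<in> tangent_space A p"
  shows "(\<lambda>c. \<Sum>j\<in>J. r j *\<^sub>R u j c) \<in> tangent_space A p"
proof -
  have "transition_deriv c c' p (\<Sum>j\<in>J. r j *\<^sub>R u j c) = (\<Sum>j\<in>J. r j *\<^sub>R u j c')"
    if "c \<in> A" "c' \<in> A" "p \<in> cdom c" "p \<in> cdom c'" for c c'
    using linear_transition_deriv[OF that] transition_deriv_component[OF assms that] that
    by (simp add: linear_sum linear_scale)
  moreover have "(\<Sum>j\<in>J. r j *\<^sub>R u j c) = 0" if "\<not> (c \<in> A \<and> p \<in> cdom c)" for c
    using tangent_component_zero[OF assms that] by simp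
  ultimately show ?thesis by (auto simp: tangent_space_def)
qed

text \<open>The chain rule for the function and the transformation law of the vector cancel, so v(f)
  does not depend on the chart chosen by \<open>chart_at\<close>.\<close>

lemma tangent_deriv_chart:
  assumes "c \<in> A" "p \<in> cdom c" "v \<in> tangent_space A p" "(f \<circ> cinv c) differentiable (at (cmap c p))"
  shows "tangent_deriv A p v f = frechet_derivative (f \<circ> cinv c) (at (cmap c p)) (v c)"
proof -
  define c' where "c' = chart_at A p"
  have c': "c' \<in> A" "p \<in> cdom c'" using chart_at_in[of p] in_chart_at[of p] cdom_subset[OF assms(1)] assms(2) by (auto simp: c'_def)
  have "frechet_derivative (f \<circ> cinv c') (at (cmap c' p))
      = (\<lambda>v. frechet_derivative (f \<circ> cinv c) (at (cmap c p)) (transition_deriv c' c p v))"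
    using has_derivative_change_chart[OF c'(1) assms(1) c'(2) assms(2) assms(4)[unfolded frechet_derivative_works]]
    by (rule frechet_derivative_at[symmetric])
  moreover have "transition_deriv c' c p (v c') = v c"
    using assms(1-3) c' by (intro transition_deriv_component)
  ultimately show ?thesis by (simp add: tangent_deriv_def c'_def[symmetric])
qed

text \<open>As x moves, \<open>chart_at\<close> at \<open>cinv c x\<close> may change; chart
  independence supplies one formula a^j \<partial>_j f on the whole chart image, and only that
  formula can be differentiated further. One order is lost.\<close>

lemma Ck_on_apply_field:
  assumes a: "smooth_vector_field X A a" and f: "Ck_function A (Suc k) f" and c: "c \<in> A"
  shows "x \<in> cimg c \<Longrightarrow> apply_field A a f (cinv c x) = frechet_derivative (f \<circ> cinv c) (at x) (a (cinv c x) c)"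
    and "Ck_on k (apply_field A a f \<circ> cinv c) (cimg c)"
proof -
  have f': "Ck_on (Suc k) (f \<circ> cinv c) (cimg c)" using f c by (simp add: Ck_function_def)
  show eq: "apply_field A a f (cinv c x) = frechet_derivative (f \<circ> cinv c) (at x) (a (cinv c x) c)"
    if "x \<in> cimg c" for x
  proof -
    have "cinv c x \<in> cdom c" using that by (rule cinv_in_cdom)
    moreover have "a (cinv c x) \<in> tangent_space A (cinv c x)"
      using a cdom_subset[OF c] calculation by (auto simp: smooth_vector_field_def)
    moreover have "(f \<circ> cinv c) differentiable (at x)"
      using f' that unfolding Ck_on.simps by blast
    ultimately show ?thesis
      using tangent_deriv_chart[OF c, of "cinv c x" "a (cinv c x)" f] that
      by (simp add: apply_field_def)
  qed
  have "Ck_on k (\<lambda>x. frechet_derivative (f \<circ> cinv c) (at x) (a (cinv c x) c)) (cimg c)"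
    by (rule Ck_on_apply_derivative[OF open_cimg[OF c]])
       (use f' a c in \<open>auto simp: smooth_vector_field_def smooth_on_def\<close>)
  then show "Ck_on k (apply_field A a f \<circ> cinv c) (cimg c)"
    by (rule Ck_on_cong_imp[OF open_cimg[OF c], rotated]) (simp add: eq)
qed

section \<open>Cutoff functions and partitions\<close>

text \<open>Two open sets cover the image of \<open>c'\<close>: the overlap with \<open>c\<close>,
  and the part outside the closed set K, where \<open>f\<close> is 0. Stated for a bare coordinate
  map \<open>f\<close>, it serves functions and vector fields alike.\<close>

lemma Ck_on_coordinates_of_cutoff:
  assumes "c \<in> A" "c' \<in> A" "closedin X K" "K \<subseteq> cdom c"
    and inside: "Ck_on k f (cmap c' ` (cdom c' \<inter> cdom c))"
    and outside: "\<And>q. q \<in> cdom c' - K \<Longrightarrow> f (cmap c' q) = 0"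
  shows "Ck_on k f (cimg c')"
proof (rule Ck_on_local)
  fix x assume "x \<in> cimg c'"
  then obtain q where q: "q \<in> cdom c'" "x = cmap c' q" by blast
  show "\<exists>T. open T \<and> x \<in> T \<and> Ck_on k f T"
  proof (cases "q \<in> cdom c")
    case True
    then show ?thesis using inside q open_overlap[OF assms(2,1)] by blast
  next
    case False
    let ?T = "cmap c' ` (cdom c' \<inter> (topspace X - K))"
    have T: "open ?T" using assms(2,3) by (intro open_cmap_image) auto
    have "Ck_on k f ?T"
      by (rule Ck_on_cong_imp[OF T _ Ck_on_const[OF T, of k 0]]) (use outside in force)
    moreover have "x \<in> ?T" using q False assms cdom_subset[OF assms(2)] by blast
    ultimately show ?thesis using T by blast
  qed
qed

lemma Ck_function_cutoff:
  assumes "c \<in> A" "closedin X K" "K \<subseteq> cdom c" "Ck_on k v (cimg c)"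
    and "\<And>q. q \<in> cdom c - K \<Longrightarrow> v (cmap c q) = 0"
  shows "Ck_function A k (\<lambda>q. if q \<in> cdom c then v (cmap c q) else 0)" (is "Ck_function A k ?f")
  unfolding Ck_function_def
proof
  fix c' assume c': "c' \<in> A"
  let ?W = "cmap c' ` (cdom c' \<inter> cdom c)"
  have W: "open ?W" using c' assms(1) by (rule open_overlap)
  have "Ck_on k (\<lambda>x. v (transition c' c x)) ?W"
    using assms(1,4) c' by (intro Ck_on_compose[OF W Ck_on_transition]) auto
  then have "Ck_on k (?f \<circ> cinv c') ?W"
    by (rule Ck_on_cong_imp[OF W, rotated]) (use c' in auto)
  then show "Ck_on k (?f \<circ> cinv c') (cimg c')"
    by (rule Ck_on_coordinates_of_cutoff[OF assms(1) c' assms(2,3)]) (use c' assms(5) in auto)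
qed

lemma smooth_vector_field_cutoff:
  assumes "c \<in> A" "closedin X K" "K \<subseteq> cdom c" "smooth_on v (cimg c)"
    and "\<And>q. q \<in> cdom c - K \<Longrightarrow> v (cmap c q) = 0"
  shows "smooth_vector_field X A (\<lambda>q. if q \<in> cdom c then tangent_of c q (v (cmap c q)) else (\<lambda>_. 0))"
    (is "smooth_vector_field X A ?a")
  unfolding smooth_vector_field_def
proof (intro conjI ballI)
  show "?a p \<in> tangent_space A p" for p
    using assms(1) by (auto intro: tangent_of_in zero_in_tangent_space)
  fix c' assume c': "c' \<in> A"
  let ?W = "cmap c' ` (cdom c' \<inter> cdom c)"
  have W: "open ?W" using c' assms(1) by (rule open_overlap)
  let ?t = "transition c' c" and ?s = "transition c c'"
  have t: "?t ` ?W \<subseteq> cmap c ` (cdom c \<inter> cdom c')" using c' by auto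
  show "smooth_on (\<lambda>x. ?a (cinv c' x) c') (cimg c')"
    unfolding smooth_on_def
  proof
    fix k
    \<comment> \<open>In \<open>c'\<close> the components are the pushforward of \<open>v\<close> by
      the transition \<open>?s\<close>, taken at the point \<open>?t x\<close> of the chart
      \<open>c\<close>. Since the derivative of \<open>?s\<close> occurs, \<open>?s\<close> enters
      with order \<open>Suc k\<close>.\<close>
    have "Ck_on k (\<lambda>x. frechet_derivative ?s (at (?t x)) (v (?t x))) ?W"
    proof (rule Ck_on_apply_derivative[OF W])
      show "Ck_on k (\<lambda>x. frechet_derivative ?s (at (?t x)) b) ?W" for b
        using Ck_on_transition[OF assms(1) c', of "Suc k"]
        by (intro Ck_on_compose[OF W Ck_on_transition[OF c' assms(1)] _ t,
              of k "\<lambda>y. frechet_derivative ?s (at y) b"]) simp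
      show "?s differentiable (at (?t x))" if "x \<in> ?W" for x
        using Ck_on_transition[OF assms(1) c', of 1] t that c' assms(1) by auto
      show "Ck_on k (\<lambda>x. v (?t x)) ?W"
        using assms(1,4) c'
        by (intro Ck_on_compose[where g = v and T = "cimg c", OF W Ck_on_transition]) (auto simp: smooth_on_def)
    qed
    then have "Ck_on k (\<lambda>x. ?a (cinv c' x) c') ?W"
      by (rule Ck_on_cong_imp[OF W, rotated]) (use c' in \<open>auto simp: tangent_of_def transition_deriv_def\<close>)
    then show "Ck_on k (\<lambda>x. ?a (cinv c' x) c') (cimg c')"
      by (rule Ck_on_coordinates_of_cutoff[OF assms(1) c' assms(2,3)])
        (use c' assms(1,5) linear_transition_deriv in \<open>auto simp: tangent_of_def linear_0\<close>)
  qed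
qed

text \<open>K is the part of a chart over a closed ball around the image of p, and the bump is
  nonzero exactly over the open ball. Openness of that set is recorded for the compactness
  argument.\<close>

lemma ex_bump:
  assumes "p \<in> topspace X"
  obtains c K \<beta> where "c \<in> A" "closedin X K" "K \<subseteq> cdom c"
    "\<And>k. Ck_function A k \<beta>" "\<And>q. q \<notin> K \<Longrightarrow> \<beta> q = 0"
    "openin X {q \<in> topspace X. \<beta> q \<noteq> (0::real)}" "\<beta> p \<noteq> 0"
proof -
  obtain c where c: "c \<in> A" "p \<in> cdom c" using ex_chart[OF assms] by blast
  then obtain r where r: "r > 0" "cball (cmap c p) r \<subseteq> cimg c"
    using open_contains_cball[of "cimg c"] open_cimg by blast
  define K where "K = cinv c ` cball (cmap c p) r"
  \<comment> \<open>\<open>flat_quot 0\<close> is exp(-1/t) for t > 0 and 0 otherwise. The squared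
    distance is used because it is smooth at the centre as well.\<close>
  define v where "v x = flat_quot 0 (r\<^sup>2 - (x - cmap c p) \<bullet> (x - cmap c p))" for x
  define \<beta> where "\<beta> q = (if q \<in> cdom c then v (cmap c q) else 0)" for q
  have v: "v x \<noteq> 0 \<longleftrightarrow> dist (cmap c p) x < r" for x
  proof -
    have "v x \<noteq> 0 \<longleftrightarrow> (dist (cmap c p) x)\<^sup>2 < r\<^sup>2"
      by (simp add: v_def flat_quot_def dist_norm norm_minus_commute power2_norm_eq_inner)
    also have "\<dots> \<longleftrightarrow> dist (cmap c p) x < r"
      using r(1) power2_less_imp_less[of "dist (cmap c p) x" r]
        power_strict_mono[of "dist (cmap c p) x" r 2] by auto
    finally show ?thesis .
  qed
  have K: "closedin X K" "K \<subseteq> cdom c"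
    using closedin_cinv_image[OF c(1) compact_cball r(2)] r(2) by (auto simp: K_def cinv_in_cdom)
  have vK: "v (cmap c q) = 0" if "q \<in> cdom c - K" for q
  proof (rule ccontr)
    assume "v (cmap c q) \<noteq> 0"
    then have "cmap c q \<in> cball (cmap c p) r" by (simp add: v)
    then have "cinv c (cmap c q) \<in> K" unfolding K_def by (rule imageI)
    then show False using that c(1) by simp
  qed
  have "Ck_on k v (cimg c)" for k
    unfolding v_def
    by (rule Ck_on_compose[OF _ _ Ck_on_flat_quot])
       (auto intro!: Ck_on_diff Ck_on_inner Ck_on_const Ck_on_id open_cimg c(1))
  then have "Ck_function A k \<beta>" for k
    unfolding \<beta>_def by (rule Ck_function_cutoff[where v = v, OF c(1) K _ vK])
  moreover have "\<beta> q = 0" if "q \<notin> K" for q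
    using that vK by (simp add: \<beta>_def)
  moreover have "openin X {q \<in> topspace X. \<beta> q \<noteq> 0}"
  proof -
    have "continuous_map (subtopology X (cdom c)) euclidean (cmap c)"
      using homeomorphic_imp_continuous_map[OF homeomorphic_cmap[OF c(1)]] continuous_map_in_subtopology
      by blast
    then have "openin (subtopology X (cdom c))
        {q \<in> topspace (subtopology X (cdom c)). cmap c q \<in> ball (cmap c p) r}"
      by (rule openin_continuous_map_preimage) simp
    moreover have "{q \<in> topspace (subtopology X (cdom c)). cmap c q \<in> ball (cmap c p) r}
        = {q \<in> topspace X. \<beta> q \<noteq> 0}"
      using v by (auto simp: \<beta>_def)
    ultimately show ?thesis
      using openin_trans_full openin_cdom[OF c(1)] by metis
  qed
  moreover have "\<beta> p \<noteq> 0" using c(2) v r(1) by (simp add: \<beta>_def)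
  ultimately show ?thesis by (rule that[OF c(1) K])
qed

text \<open>By compactness finitely many bumps have no common zero, so the sum of their squares is
  positive and its square root can be divided out smoothly. The index of a bump is the point around
  which it was built.\<close>

lemma ex_partition_squares:
  assumes "compact_space X"
  obtains I :: "'m set" and c K \<rho> where "finite I"
    "\<And>i. i \<in> I \<Longrightarrow> c i \<in> A" "\<And>i. i \<in> I \<Longrightarrow> closedin X (K i)" "\<And>i. i \<in> I \<Longrightarrow> K i \<subseteq> cdom (c i)"
    "\<And>i k. i \<in> I \<Longrightarrow> Ck_function A k (\<rho> i)" "\<And>i q. i \<in> I \<Longrightarrow> q \<notin> K i \<Longrightarrow> \<rho> i q = 0"
    "\<And>q. q \<in> topspace X \<Longrightarrow> (\<Sum>i\<in>I. (\<rho> i q)\<^sup>2) = (1::real)"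
proof -
  have "\<forall>p\<in>topspace X. \<exists>c K \<beta>. c \<in> A \<and> closedin X K \<and> K \<subseteq> cdom c \<and>
    (\<forall>k. Ck_function A k \<beta>) \<and> (\<forall>q. q \<notin> K \<longrightarrow> \<beta> q = 0) \<and>
    openin X {q \<in> topspace X. \<beta> q \<noteq> 0} \<and> \<beta> p \<noteq> 0"
    by (intro ballI) (rule ex_bump, assumption, blast)
  then obtain c K \<beta> where "\<forall>p\<in>topspace X. c p \<in> A \<and> closedin X (K p) \<and> K p \<subseteq> cdom (c p) \<and>
    (\<forall>k. Ck_function A k (\<beta> p)) \<and> (\<forall>q. q \<notin> K p \<longrightarrow> \<beta> p q = 0) \<and>
    openin X {q \<in> topspace X. \<beta> p q \<noteq> 0} \<and> \<beta> p p \<noteq> 0"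
    unfolding bchoice_iff by blast
  then have b: "\<And>p. p \<in> topspace X \<Longrightarrow> c p \<in> A"
    "\<And>p. p \<in> topspace X \<Longrightarrow> closedin X (K p)" "\<And>p. p \<in> topspace X \<Longrightarrow> K p \<subseteq> cdom (c p)"
    "\<And>p k. p \<in> topspace X \<Longrightarrow> Ck_function A k (\<beta> p)"
    "\<And>p q. p \<in> topspace X \<Longrightarrow> q \<notin> K p \<Longrightarrow> \<beta> p q = 0"
    "\<And>p. p \<in> topspace X \<Longrightarrow> openin X {q \<in> topspace X. \<beta> p q \<noteq> 0}"
    "\<And>p. p \<in> topspace X \<Longrightarrow> \<beta> p p \<noteq> 0"
    by simp_all
  define U where "U p = {q \<in> topspace X. \<beta> p q \<noteq> 0}" for p
  have "(\<forall>V\<in>U ` topspace X. openin X V) \<and> topspace X \<subseteq> \<Union> (U ` topspace X)"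
    using b(6,7) by (auto simp: U_def)
  then obtain F where "finite F" "F \<subseteq> U ` topspace X" "topspace X \<subseteq> \<Union> F"
    using assms unfolding compact_space_alt by meson
  then obtain I where I: "finite I" "I \<subseteq> topspace X" "topspace X \<subseteq> \<Union> (U ` I)"
    by (metis finite_subset_image)
  define s where "s q = (\<Sum>i\<in>I. (\<beta> i q)\<^sup>2)" for q
  define \<rho> where "\<rho> i q = \<beta> i q * inverse (sqrt (s q))" for i q
  have s: "s q > 0" if q: "q \<in> topspace X" for q
  proof -
    obtain i where "i \<in> I" "\<beta> i q \<noteq> 0" using I(3) q unfolding U_def by blast
    then show ?thesis unfolding s_def using I(1) by (intro sum_pos2[of I i]) auto
  qed
  have "Ck_function A k (\<rho> i)" if "i \<in> I" for i k
    unfolding Ck_function_def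
  proof
    fix c assume c: "c \<in> A"
    have \<beta>: "Ck_on k (\<lambda>x. \<beta> i (cinv c x)) (cimg c)" if "i \<in> I" for i
      using b(4)[of i k] c that I(2) by (auto simp: Ck_function_def o_def)
    have s': "Ck_on k (\<lambda>x. s (cinv c x)) (cimg c)"
      unfolding s_def power2_eq_square
      by (intro Ck_on_sum Ck_on_mult open_cimg c \<beta>)
    have "(\<lambda>x. s (cinv c x)) ` cimg c \<subseteq> {0<..}"
    proof (rule image_subsetI)
      fix x assume "x \<in> cimg c"
      then have "cinv c x \<in> topspace X" by (rule subsetD[OF cdom_subset[OF c] cinv_in_cdom])
      then show "s (cinv c x) \<in> {0<..}" using s by simp
    qed
    then show "Ck_on k (\<rho> i \<circ> cinv c) (cimg c)"
      unfolding \<rho>_def o_def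
      by (intro Ck_on_mult[OF open_cimg[OF c] \<beta>[OF \<open>i \<in> I\<close>]]
          Ck_on_compose[OF open_cimg[OF c] s' Ck_on_inverse_sqrt])
  qed
  moreover have "\<rho> i q = 0" if "i \<in> I" "q \<notin> K i" for i q
    using b(5) that I(2) by (auto simp: \<rho>_def)
  moreover have "(\<Sum>i\<in>I. (\<rho> i q)\<^sup>2) = 1" if "q \<in> topspace X" for q
  proof -
    have "(\<Sum>i\<in>I. (\<rho> i q)\<^sup>2) = s q * inverse (s q)"
      using s[OF that] by (simp add: \<rho>_def power_mult_distrib power_inverse s_def sum_distrib_right less_imp_le)
    then show ?thesis using s[OF that] by simp
  qed
  ultimately show ?thesis
    using that[of I c K \<rho>] b(1-3) I(1,2) by blast
qed

end

section \<open>Frames of a Riemannian metric\<close>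

locale riemannian = manifold X A
  for X :: "'m topology" and A :: "('m, 'd::finite) chart set" +
  fixes h :: "'m \<Rightarrow> ('m, 'd) tangent \<Rightarrow> ('m, 'd) tangent \<Rightarrow> real"
  assumes metric: "riemannian_metric X A h"
begin

section \<open>The metric in coordinates\<close>

lemma
  assumes "p \<in> topspace X" "u \<in> tangent_space A p" "v \<in> tangent_space A p"
  shows metric_linear: "w \<in> tangent_space A p \<Longrightarrow> h p (\<lambda>c. r *\<^sub>R u c + s *\<^sub>R v c) w = r * h p u w + s * h p v w"
    and metric_sym: "h p u v = h p v u"
    and metric_pos: "v \<noteq> (\<lambda>_. 0) \<Longrightarrow> h p v v > 0"
  using metric assms by (auto simp: riemannian_metric_def)

lemma metric_tangent_of:
  assumes "c \<in> A" "p \<in> cdom c"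
  shows "h p (tangent_of c p u) (tangent_of c p v) = u \<bullet> (metric_matrix A h c p *v v)"
proof -
  have p: "p \<in> topspace X" using assms cdom_subset by blast
  note T = tangent_of_in[OF assms]
  define B where "B u v = h p (tangent_of c p u) (tangent_of c p v)" for u v
  have B1: "B (r *\<^sub>R u + s *\<^sub>R u') v = r * B u v + s * B u' v" for r s u u' v
    unfolding B_def tangent_of_linear_comb[OF assms] by (rule metric_linear[OF p T T T])
  have sym: "B u v = B v u" for u v unfolding B_def by (rule metric_sym[OF p T T])
  have lin: "linear (\<lambda>u. B u v)" for v
    using B1[of 1 _ 1] B1[of _ _ 0 0] by (intro linearI) auto
  have expand: "B u v = (\<Sum>i\<in>UNIV. u $ i * B (axis i 1) v)" for u v
    using linear_sum[OF lin, of "\<lambda>i. u $ i *\<^sub>R axis i 1" UNIV v] linear_scale[OF lin]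
    by (simp add: basis_expansion[of u, unfolded scalar_mult_eq_scaleR])
  \<comment> \<open>Linearity is at hand in the first slot only; symmetry swaps the slots, the
    former second argument is expanded, and another swap restores the order.\<close>
  have "B u v = (\<Sum>i\<in>UNIV. u $ i * (\<Sum>j\<in>UNIV. v $ j * B (axis i 1) (axis j 1)))"
    by (subst expand, subst sym, subst expand, subst sym) (rule refl)
  then show ?thesis
    by (simp add: inner_vec_def matrix_vector_mult_def metric_matrix_def coord_vector_eq B_def mult.commute)
qed

lemma metric_components:
  assumes "c \<in> A" "p \<in> cdom c" "u \<in> tangent_space A p" "v \<in> tangent_space A p"
  shows "h p u v = u c \<bullet> (metric_matrix A h c p *v v c)"
  using metric_tangent_of[OF assms(1,2), of "u c" "v c"] tangent_of_component assms by simp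

lemma metric_matrix_sym:
  assumes "c \<in> A" "p \<in> cdom c"
  shows "v \<bullet> (metric_matrix A h c p *v w) = w \<bullet> (metric_matrix A h c p *v v)"
proof -
  have "p \<in> topspace X" using assms cdom_subset by blast
  then show ?thesis
    using metric_sym[OF _ tangent_of_in[OF assms] tangent_of_in[OF assms]]
    by (simp flip: metric_tangent_of[OF assms])
qed

lemma metric_matrix_pos:
  assumes "c \<in> A" "p \<in> cdom c" "v \<noteq> 0"
  shows "v \<bullet> (metric_matrix A h c p *v v) > 0"
proof -
  have "p \<in> topspace X" using assms cdom_subset by blast
  moreover have "tangent_of c p v \<noteq> (\<lambda>_. 0)" using assms tangent_of_self[of c p v] by metis
  ultimately show ?thesis
    using metric_pos[OF _ tangent_of_in tangent_of_in, of p c c v] assms by (simp flip: metric_tangent_of[OF assms(1,2)])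
qed

lemma smooth_metric_matrix: "c \<in> A \<Longrightarrow> smooth_on (\<lambda>x. metric_matrix A h c (cinv c x)) (cimg c)"
  using metric by (simp add: riemannian_metric_def)

text \<open>In coordinates this says $\sum_j a_j \otimes a_j = 2 h^{-1}$.\<close>

definition frame_identity :: "'i set \<Rightarrow> ('i \<Rightarrow> 'm \<Rightarrow> ('m, 'd) tangent) \<Rightarrow> bool" where
  "frame_identity J a \<longleftrightarrow> (\<forall>c\<in>A. \<forall>p\<in>cdom c. \<forall>w.
     (\<Sum>j\<in>J. (w \<bullet> (metric_matrix A h c p *v a j p c)) *\<^sub>R a j p c) = 2 *\<^sub>R w)"

section \<open>Gradient and Laplacian through a frame, and existence of such frames\<close>

lemma gradient_frame:
  assumes a: "\<And>j. j \<in> J \<Longrightarrow> smooth_vector_field X A (a j)" and frame: "frame_identity J a"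
    and f: "Ck_function A 1 f" and p: "p \<in> topspace X"
  shows "gradient A h f p = (\<lambda>c. \<Sum>j\<in>J. (apply_field A (a j) f p / 2) *\<^sub>R a j p c)"
proof -
  define v where "v = (\<lambda>c. \<Sum>j\<in>J. (apply_field A (a j) f p / 2) *\<^sub>R a j p c)"
  obtain c where c: "c \<in> A" "p \<in> cdom c" using ex_chart[OF p] by blast
  let ?G = "metric_matrix A h c p" and ?L = "frechet_derivative (f \<circ> cinv c) (at (cmap c p))"
  have aT: "a j p \<in> tangent_space A p" if "j \<in> J" for j
    using a[OF that] p by (auto simp: smooth_vector_field_def)
  have vT: "v \<in> tangent_space A p" unfolding v_def using aT by (rule tangent_space_sum)
  have f': "(f \<circ> cinv c) differentiable (at (cmap c p))"
    using f c by (auto simp: Ck_function_def)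
  then have lin: "linear ?L" by (rule linear_frechet_derivative)
  have af: "apply_field A (a j) f p = ?L (a j p c)" if "j \<in> J" for j
    unfolding apply_field_def using tangent_deriv_chart[OF c aT[OF that] f'] .
  have v: "h p w v = tangent_deriv A p w f" if w: "w \<in> tangent_space A p" for w
  proof -
    \<comment> \<open>By linearity of df the sum moves inside: half the sum of df(a_j) h(w, a_j) is
      half of df applied to the sum of h(w, a_j) a_j, which the frame identity evaluates to
      2w.\<close>
    have "h p w v = (\<Sum>j\<in>J. (?L (a j p c) / 2) * (w c \<bullet> (?G *v a j p c)))"
      unfolding metric_components[OF c w vT]
      by (simp add: v_def inner_sum_right matrix_vector_mult_scaleR af
          linear_sum[OF matrix_vector_mul_linear])
    also have "\<dots> = ?L (\<Sum>j\<in>J. (w c \<bullet> (?G *v a j p c)) *\<^sub>R a j p c) / 2"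
      by (simp add: linear_sum[OF lin] linear_scale[OF lin] sum_divide_distrib mult.commute)
    also have "\<dots> = ?L (2 *\<^sub>R w c) / 2"
      using frame c by (simp add: frame_identity_def)
    also have "\<dots> = ?L (w c)" by (simp add: linear_scale[OF lin])
    finally show ?thesis using tangent_deriv_chart[OF c w f'] by simp
  qed
  \<comment> \<open>The definite description in \<open>gradient\<close> needs uniqueness too:
    testing against the vector with components \<open>u c - v c\<close> and using positive
    definiteness forces equality.\<close>
  have "u = v" if u: "u \<in> tangent_space A p" "\<forall>w\<in>tangent_space A p. h p w u = tangent_deriv A p w f" for u
  proof -
    define w where "w = tangent_of c p (u c - v c)"
    have w: "w \<in> tangent_space A p" "w c = u c - v c" unfolding w_def using c by (auto intro: tangent_of_in)
    have "h p w u = h p w v" using u(2) v w(1) by simp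
    then have "(u c - v c) \<bullet> (?G *v (u c - v c)) = 0"
      by (simp add: metric_components[OF c w(1)] u(1) vT w(2) matrix_vector_mult_diff_distrib inner_diff_right)
    then have "u c = v c" using metric_matrix_pos[OF c, of "u c - v c"] by force
    then show ?thesis using tangent_space_eqI[OF u(1) vT c] by blast
  qed
  then have "gradient A h f p = v"
    unfolding gradient_def by (intro the_equality) (use vT v in blast)+
  then show ?thesis by (simp add: v_def)
qed

text \<open>The product rule is carried out in the single chart that evaluates the divergence at p.
  Differentiating the coefficients a_j(f) gives a_j(a_j(f)); differentiating density times a_j gives
  the divergence terms.\<close>

lemma laplace_frame:
  assumes a: "\<And>j. j \<in> J \<Longrightarrow> smooth_vector_field X A (a j)" and frame: "frame_identity J a"
    and f: "Ck_function A 2 f" and p: "p \<in> topspace X"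
  shows "1 / 2 * (\<Sum>j\<in>J. apply_field A (a j) (apply_field A (a j) f) p) =
     laplace_beltrami A h f p - 1 / 2 * (\<Sum>j\<in>J. div_times_field A h (a j) f p)"
proof -
  define c where "c = chart_at A p"
  have c: "c \<in> A" "p \<in> cdom c" using chart_at_in[OF p] in_chart_at[OF p] by (simp_all add: c_def)
  define x0 where "x0 = cmap c p"
  have x0: "x0 \<in> cimg c" "cinv c x0 = p" using c by (auto simp: x0_def)
  \<comment> \<open>\<open>g\<close> is the Riemannian volume density, \<open>F j\<close> is a_j(f)
    in coordinates, and \<open>H j i\<close> is the density times a component, the quantity that the
    divergence differentiates.\<close>
  define g where "g x = sqrt (det (metric_matrix A h c (cinv c x)))" for x
  define F where "F j x = apply_field A (a j) f (cinv c x)" for j x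
  define H where "H j i x = g x * a j (cinv c x) c $ i" for j i x
  define F' where "F' j = frechet_derivative (F j) (at x0)" for j
  define H' where "H' j i = frechet_derivative (H j i) (at x0)" for j i
  have f1: "Ck_function A 1 f"
    using f by (auto simp: Ck_function_def numeral_2_eq_2 intro: Ck_on_Suc_imp simp del: Ck_on.simps)
  have F1: "Ck_on 1 (F j) (cimg c)" if "j \<in> J" for j
    using Ck_on_apply_field(2)[OF a[OF that], of 1 f c] f c(1)
    by (simp add: F_def[abs_def] o_def numeral_2_eq_2)
  then have F': "(F j has_derivative F' j) (at x0)" if "j \<in> J" for j
    unfolding F'_def using that x0(1) by (intro Ck_on_SucD_has_derivative[of 0]) auto
  have det: "det (metric_matrix A h c (cinv c x0)) > 0"
    unfolding x0(2) using metric_matrix_sym[OF c] metric_matrix_pos[OF c] by (rule det_pos_definite)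
  then have g0: "g x0 > 0" by (simp add: g_def)
  have "Ck_on 1 (\<lambda>x. det (metric_matrix A h c (cinv c x))) (cimg c)"
    using smooth_metric_matrix[OF c(1)] by (intro Ck_on_det open_cimg c) (simp add: smooth_on_def)
  then have "(\<lambda>x. det (metric_matrix A h c (cinv c x))) differentiable (at x0)"
    using x0(1) by auto
  then have g: "g differentiable (at x0)"
    unfolding g_def[abs_def] differentiable_def using has_derivative_real_sqrt[where g = "\<lambda>x. det (metric_matrix A h c (cinv c x))", OF det] by blast
  have "Ck_on 1 (\<lambda>x. a j (cinv c x) c $ i) (cimg c)" if "j \<in> J" for i j
    using a[OF that] c(1)
    by (intro Ck_on_vec_nth open_cimg) (auto simp: smooth_vector_field_def smooth_on_def simp del: Ck_on.simps)
  then have "H j i differentiable (at x0)" if "j \<in> J" for i j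
    unfolding H_def[abs_def] using g that x0(1) by (intro differentiable_mult) auto
  then have H': "(H j i has_derivative H' j i) (at x0)" if "j \<in> J" for i j
    using that by (simp add: H'_def frechet_derivative_works)
  have div: "divergence A h (a j) p = (\<Sum>i\<in>UNIV. H' j i (axis i 1)) / g x0" for j
    unfolding divergence_def divergence_in_chart_def c_def[symmetric] x0_def[symmetric]
    by (simp add: H'_def H_def[abs_def] g_def[abs_def] x0(2))
  \<comment> \<open>At p itself the outer derivative is by definition taken in the chart
    \<open>c\<close>, so unfolding suffices.\<close>
  have second: "apply_field A (a j) (apply_field A (a j) f) p = F' j (a j p c)" if "j \<in> J" for j
  proof -
    have "tangent_deriv A p (a j p) (apply_field A (a j) f)
        = frechet_derivative (apply_field A (a j) f \<circ> cinv c) (at (cmap c p)) (a j p c)"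
      by (simp add: tangent_deriv_def c_def Let_def)
    then show ?thesis by (simp add: apply_field_def[of A "a j" "apply_field A (a j) f"] F'_def F_def[abs_def] x0_def o_def)
  qed
  \<comment> \<open>The formula is required on the whole chart image and not just at
    \<open>x0\<close>, since this product is differentiated next.\<close>
  have grad: "g x * gradient A h f (cinv c x) c $ i = (\<Sum>j\<in>J. F j x / 2 * H j i x)" if "x \<in> cimg c" for x i
  proof -
    have "cinv c x \<in> topspace X" using cinv_in_cdom[OF that] cdom_subset[OF c(1)] by blast
    then show ?thesis
      using gradient_frame[OF a frame f1]
      by (simp add: F_def H_def sum_distrib_left ac_simps)
  qed
  have "((\<lambda>x. g x * gradient A h f (cinv c x) c $ i) has_derivative
      (\<lambda>v. \<Sum>j\<in>J. F j x0 / 2 * H' j i v + F' j v / 2 * H j i x0)) (at x0)" for i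
  proof (rule has_derivative_transform_within_open[where f = "\<lambda>x. \<Sum>j\<in>J. F j x / 2 * H j i x"])
    show "((\<lambda>x. \<Sum>j\<in>J. F j x / 2 * H j i x) has_derivative
      (\<lambda>v. \<Sum>j\<in>J. F j x0 / 2 * H' j i v + F' j v / 2 * H j i x0)) (at x0)"
      by (intro has_derivative_sum has_derivative_mult H'
          bounded_linear.has_derivative[OF bounded_linear_divide F'])
  qed (use grad x0(1) open_cimg[OF c(1)] in auto)
  then have "frechet_derivative (\<lambda>x. g x * gradient A h f (cinv c x) c $ i) (at x0) =
      (\<lambda>v. \<Sum>j\<in>J. F j x0 / 2 * H' j i v + F' j v / 2 * H j i x0)" for i
    by (rule frechet_derivative_at[symmetric])
  then have "laplace_beltrami A h f p =
      (\<Sum>i\<in>UNIV. \<Sum>j\<in>J. F j x0 / 2 * H' j i (axis i 1) + F' j (axis i 1) / 2 * H j i x0) / g x0"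
    unfolding laplace_beltrami_def divergence_def divergence_in_chart_def c_def[symmetric] x0_def[symmetric]
    by (simp add: g_def[symmetric] x0(2)[symmetric])
  also have "\<dots> = (\<Sum>j\<in>J. F j x0 / 2 * ((\<Sum>i\<in>UNIV. H' j i (axis i 1)) / g x0)
      + (\<Sum>i\<in>UNIV. F' j (axis i 1) * (a j p c $ i)) / 2)"
  proof -
    \<comment> \<open>Dividing by \<open>g x0\<close> turns the first term into the divergence and
      cancels the density contained in \<open>H j i x0\<close> in the second.\<close>
    have "(\<Sum>i\<in>UNIV. F j x0 / 2 * H' j i (axis i 1) + F' j (axis i 1) / 2 * H j i x0) / g x0
       = F j x0 / 2 * ((\<Sum>i\<in>UNIV. H' j i (axis i 1)) / g x0)
         + (\<Sum>i\<in>UNIV. F' j (axis i 1) * (a j p c $ i)) / 2" for j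
      using g0 by (simp add: H_def x0(2) sum.distrib sum_distrib_left sum_divide_distrib add_divide_distrib)
    then show ?thesis by (subst sum.swap) (simp add: sum_divide_distrib[of _ _ "g x0"])
  qed
  also have "\<dots> = (\<Sum>j\<in>J. div_times_field A h (a j) f p / 2
      + apply_field A (a j) (apply_field A (a j) f) p / 2)"
  proof (rule sum.cong[OF refl])
    fix j assume j: "j \<in> J"
    have "F' j (a j p c) = (\<Sum>i\<in>UNIV. F' j (axis i 1) * (a j p c $ i))"
      using linear_sum[OF has_derivative_linear[OF F'[OF j]], of "\<lambda>i. (a j p c $ i) *\<^sub>R axis i 1" UNIV]
      by (simp add: basis_expansion[of "a j p c", unfolded scalar_mult_eq_scaleR]
          linear_scale[OF has_derivative_linear[OF F'[OF j]]] mult.commute)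
    then show "F j x0 / 2 * ((\<Sum>i\<in>UNIV. H' j i (axis i 1)) / g x0)
        + (\<Sum>i\<in>UNIV. F' j (axis i 1) * (a j p c $ i)) / 2
      = div_times_field A h (a j) f p / 2 + apply_field A (a j) (apply_field A (a j) f) p / 2"
      by (simp add: second[OF j] div_times_field_def div F_def x0(2) mult.commute)
  qed
  finally show ?thesis by (simp add: sum.distrib sum_divide_distrib)
qed

text \<open>At each point the d fields of block i satisfy the frame identity with 2 \<rho>_i^2 in
  place of 2, and summing over i removes the weights. The blocks come from different charts, while
  the identity is asserted in every chart, so pairings and components are transported.\<close>

lemma ex_frame:
  fixes I :: "'i set"
  assumes c: "\<And>i. i \<in> I \<Longrightarrow> c i \<in> A" and K: "\<And>i. i \<in> I \<Longrightarrow> closedin X (K i)" "\<And>i. i \<in> I \<Longrightarrow> K i \<subseteq> cdom (c i)"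
    and \<rho>: "\<And>i k. i \<in> I \<Longrightarrow> Ck_function A k (\<rho> i)" "\<And>i q. i \<in> I \<Longrightarrow> q \<notin> K i \<Longrightarrow> \<rho> i q = 0"
    and sum: "\<And>q. q \<in> topspace X \<Longrightarrow> (\<Sum>i\<in>I. (\<rho> i q)\<^sup>2) = (1::real)"
  obtains a :: "'i \<times> 'd \<Rightarrow> 'm \<Rightarrow> ('m, 'd) tangent" where
    "\<And>j. j \<in> I \<times> UNIV \<Longrightarrow> smooth_vector_field X A (a j)" "frame_identity (I \<times> UNIV) a"
proof -
  let ?G = "\<lambda>c x. metric_matrix A h c (cinv c x)"
  have "\<exists>e :: 'd \<Rightarrow> real^'d \<Rightarrow> real^'d. (\<forall>k. smooth_on (e k) (cimg (c i))) \<and>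
      (\<forall>x\<in>cimg (c i). \<forall>k l. e k x \<bullet> (?G (c i) x *v e l x) = (if k = l then 1 else 0))" if "i \<in> I" for i
  proof -
    have ci: "c i \<in> A" using c that .
    obtain e :: "'d \<Rightarrow> real^'d \<Rightarrow> real^'d" where "\<And>k. smooth_on (e k) (cimg (c i))"
      "\<And>x k l. x \<in> cimg (c i) \<Longrightarrow> e k x \<bullet> (?G (c i) x *v e l x) = (if k = l then 1 else 0)"
      using smooth_orthonormal_frame[OF open_cimg[OF ci] smooth_metric_matrix[OF ci]
          metric_matrix_sym[OF ci cinv_in_cdom] metric_matrix_pos[OF ci cinv_in_cdom]] by blast
    then show ?thesis by blast
  qed
  then obtain e :: "'i \<Rightarrow> 'd \<Rightarrow> real^'d \<Rightarrow> real^'d" where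
    e: "\<And>i k. i \<in> I \<Longrightarrow> smooth_on (e i k) (cimg (c i))"
    "\<And>i x k l. i \<in> I \<Longrightarrow> x \<in> cimg (c i) \<Longrightarrow> e i k x \<bullet> (?G (c i) x *v e i l x) = (if k = l then 1 else 0)"
    by metis
  \<comment> \<open>The frame identity is quadratic in the fields, so \<open>sqrt 2 * \<rho>\<close>
    yields the weight 2 \<rho>^2.\<close>
  define v where "v i k x = (sqrt 2 * \<rho> i (cinv (c i) x)) *\<^sub>R e i k x" for i k x
  define a where "a = (\<lambda>(i, k) q. if q \<in> cdom (c i) then tangent_of (c i) q (v i k (cmap (c i) q)) else (\<lambda>_. 0))"
  have "smooth_vector_field X A (a (i, k))" if i: "i \<in> I" for i k
  proof -
    have "Ck_on n (v i k) (cimg (c i))" for n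
      using \<rho>(1)[OF i, of n] c[OF i] e(1)[OF i, of k] unfolding v_def
      by (intro Ck_on_scaleR Ck_on_mult Ck_on_const open_cimg) (auto simp: Ck_function_def smooth_on_def o_def)
    then have "smooth_on (v i k) (cimg (c i))" by (simp add: smooth_on_def)
    then show ?thesis
      unfolding a_def prod.case
      by (rule smooth_vector_field_cutoff[OF c[OF i] K(1)[OF i] K(2)[OF i]]) (simp add: v_def c[OF i] \<rho>(2)[OF i])
  qed
  moreover have "frame_identity (I \<times> UNIV) a"
    unfolding frame_identity_def
  proof (intro ballI allI)
    fix c' q and w :: "real^'d" assume c': "c' \<in> A" "q \<in> cdom c'"
    define W where "W = tangent_of c' q w"
    have q: "q \<in> topspace X" using c' cdom_subset by blast
    have W: "W \<in> tangent_space A q" "W c' = w" using c' by (auto simp: W_def tangent_of_in)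
    have "(\<Sum>k\<in>UNIV. (w \<bullet> (metric_matrix A h c' q *v a (i, k) q c')) *\<^sub>R a (i, k) q c') = (2 * (\<rho> i q)\<^sup>2) *\<^sub>R w"
      if i: "i \<in> I" for i
    proof (cases "q \<in> cdom (c i)")
      case False
      \<comment> \<open>Outside the i-th chart the fields are 0 by definition, and the weight agrees
        because K i, hence the support of \<open>\<rho> i\<close>, lies in that chart.\<close>
      then have "\<rho> i q = 0" using \<rho>(2) K(2) i by blast
      then show ?thesis using False by (simp add: a_def)
    next
      case True
      let ?x = "cmap (c i) q" and ?G = "metric_matrix A h (c i) q"
      note ci = c[OF i] True
      have lin: "linear (transition_deriv (c i) c' q)" using ci c' by (intro linear_transition_deriv)
      have x: "?x \<in> cimg (c i)" using True by blast
      have aT: "a (i, k) q \<in> tangent_space A q" for k using ci by (simp add: a_def tangent_of_in)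
      have ai: "a (i, k) q (c i) = (sqrt 2 * \<rho> i q) *\<^sub>R e i k ?x" for k
        using ci by (simp add: a_def v_def)
      have "(w \<bullet> (metric_matrix A h c' q *v a (i, k) q c')) *\<^sub>R a (i, k) q c'
        = (2 * (\<rho> i q)\<^sup>2) *\<^sub>R transition_deriv (c i) c' q ((W (c i) \<bullet> (?G *v e i k ?x)) *\<^sub>R e i k ?x)" for k
      proof -
        \<comment> \<open>Both sides equal \<open>h q W (a (i, k) q)\<close>, so the pairing can be
          computed in the chart where the field is a multiple of an orthonormal frame
          vector.\<close>
        have "w \<bullet> (metric_matrix A h c' q *v a (i, k) q c') = W (c i) \<bullet> (?G *v a (i, k) q (c i))"
          using metric_components[OF c' W(1) aT] metric_components[OF ci W(1) aT] W(2) by simp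
        then have m: "w \<bullet> (metric_matrix A h c' q *v a (i, k) q c')
            = sqrt 2 * \<rho> i q * (W (c i) \<bullet> (?G *v e i k ?x))"
          by (simp add: ai matrix_vector_mult_scaleR)
        have "a (i, k) q c' = transition_deriv (c i) c' q (a (i, k) q (c i))"
          using transition_deriv_component[OF aT] ci c' by simp
        then have "a (i, k) q c' = (sqrt 2 * \<rho> i q) *\<^sub>R transition_deriv (c i) c' q (e i k ?x)"
          by (simp add: ai linear_scale[OF lin])
        then show ?thesis
          unfolding m by (simp add: linear_scale[OF lin] power2_eq_square)
      qed
      then have "(\<Sum>k\<in>UNIV. (w \<bullet> (metric_matrix A h c' q *v a (i, k) q c')) *\<^sub>R a (i, k) q c')
        = (2 * (\<rho> i q)\<^sup>2) *\<^sub>R transition_deriv (c i) c' q (\<Sum>k\<in>UNIV. (W (c i) \<bullet> (?G *v e i k ?x)) *\<^sub>R e i k ?x)"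
        by (simp add: linear_sum[OF lin] scaleR_sum_right)
      also have "(\<Sum>k\<in>UNIV. (W (c i) \<bullet> (?G *v e i k ?x)) *\<^sub>R e i k ?x) = W (c i)"
        using e(2)[OF i x] ci metric_matrix_sym[OF ci] by (intro orthonormal_expansion) auto
      also have "transition_deriv (c i) c' q (W (c i)) = w"
        using transition_deriv_component[OF W(1)] W(2) ci c' by simp
      finally show ?thesis .
    qed
    then have "(\<Sum>i\<in>I. \<Sum>k\<in>UNIV. (w \<bullet> (metric_matrix A h c' q *v a (i, k) q c')) *\<^sub>R a (i, k) q c')
      = (\<Sum>i\<in>I. (2 * (\<rho> i q)\<^sup>2) *\<^sub>R w)"
      by (rule sum.cong[OF refl])
    also have "\<dots> = (2 * (\<Sum>i\<in>I. (\<rho> i q)\<^sup>2)) *\<^sub>R w"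
      by (simp add: scaleR_sum_left sum_distrib_left)
    finally show "(\<Sum>j\<in>I \<times> UNIV. (w \<bullet> (metric_matrix A h c' q *v a j q c')) *\<^sub>R a j q c') = 2 *\<^sub>R w"
      using sum[OF q] by (simp add: sum.cartesian_product case_prod_unfold)
  qed
  ultimately show ?thesis using that[of a] by auto
qed

end

theorem lemma1p2:
  fixes X :: "'m topology" and A P :: "('m, 'd::finite) chart set"
  assumes "smooth_manifold X A"
    and "compact_space X"
    and "connected_space X"
    and "orientation X A P"
  shows "\<exists>N::nat. \<forall>h. riemannian_metric X A h \<longrightarrow>
    (\<exists>a :: nat \<Rightarrow> 'm \<Rightarrow> ('m, 'd) tangent.
       (\<forall>i\<in>{1..N}. smooth_vector_field X A (a i)) \<and>
       (\<forall>\<psi>. Ck_function A 2 \<psi> \<longrightarrow>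
          (\<forall>p\<in>topspace X.
             1 / 2 * (\<Sum>i=1..N. apply_field A (a i) (apply_field A (a i) \<psi>) p) =
             laplace_beltrami A h \<psi> p - 1 / 2 * (\<Sum>i=1..N. div_times_field A h (a i) \<psi> p))))"
proof -
  interpret manifold X A by unfold_locales (rule assms(1))
  obtain I :: "'m set" and c K \<rho> where I: "finite I"
    "\<And>i. i \<in> I \<Longrightarrow> c i \<in> A" "\<And>i. i \<in> I \<Longrightarrow> closedin X (K i)" "\<And>i. i \<in> I \<Longrightarrow> K i \<subseteq> cdom (c i)"
    "\<And>i k. i \<in> I \<Longrightarrow> Ck_function A k (\<rho> i)" "\<And>i q. i \<in> I \<Longrightarrow> q \<notin> K i \<Longrightarrow> \<rho> i q = 0"
    "\<And>q. q \<in> topspace X \<Longrightarrow> (\<Sum>i\<in>I. (\<rho> i q)\<^sup>2) = (1::real)"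
    by (rule ex_partition_squares[OF assms(2)]) (rule that)
  let ?J = "I \<times> (UNIV :: 'd set)"
  \<comment> \<open>The fields are to be numbered from 1 to N, so the index pairs are enumerated.
    Cover, cutoffs and enumeration are all fixed before \<open>h\<close> appears, as the order of
    quantifiers demands.\<close>
  obtain n where n: "bij_betw n {1..card ?J} ?J"
    using ex_bij_betw_nat_finite_1[of ?J] I(1) by auto
  show ?thesis
  proof (intro exI[of _ "card ?J"] allI impI)
    fix h assume "riemannian_metric X A h"
    then interpret riemannian X A h by unfold_locales
    obtain a where a: "\<And>j. j \<in> ?J \<Longrightarrow> smooth_vector_field X A (a j)" "frame_identity ?J a"
      by (rule ex_frame[of I c K \<rho>]) (use I in blast)+
    have sm: "smooth_vector_field X A (a (n i))" if "i \<in> {1..card ?J}" for i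
      using a(1) bij_betwE[OF n] that by blast
    have "frame_identity {1..card ?J} (a \<circ> n)"
      unfolding frame_identity_def
    proof (intro ballI allI)
      fix c p and w :: "real^'d" assume "c \<in> A" "p \<in> cdom c"
      then show "(\<Sum>i\<in>{1..card ?J}. (w \<bullet> (metric_matrix A h c p *v (a \<circ> n) i p c)) *\<^sub>R (a \<circ> n) i p c) = 2 *\<^sub>R w"
        using a(2) sum.reindex_bij_betw[OF n, of "\<lambda>j. (w \<bullet> (metric_matrix A h c p *v a j p c)) *\<^sub>R a j p c"]
        by (simp add: frame_identity_def)
    qed
    then show "\<exists>a. (\<forall>i\<in>{1..card ?J}. smooth_vector_field X A (a i)) \<and>
       (\<forall>\<psi>. Ck_function A 2 \<psi> \<longrightarrow>
          (\<forall>p\<in>topspace X.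
             1 / 2 * (\<Sum>i=1..card ?J. apply_field A (a i) (apply_field A (a i) \<psi>) p) =
             laplace_beltrami A h \<psi> p - 1 / 2 * (\<Sum>i=1..card ?J. div_times_field A h (a i) \<psi> p)))"
      using sm laplace_frame[of "{1..card ?J}" "a \<circ> n"] by (intro exI[of _ "a \<circ> n"]) auto
  qed
qed

end
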